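(* Let $\mu>-1$, $q>-1$, $0<\gamma<1$. (a) Let $L$ be positive, absolutely continuous and nondecreasing on $(0,\infty)$, and set $w(x)=x^qL(x)$. Then $w$ is an upper $q$-power weight, and hence for every $\theta\in(\gamma,1)$ and all $x>0$, $$\int_0^x e^{-\gamma t}w(t)t^{-\mu}I_\mu(t)\,dt\le M_{\mu,q,\gamma}(\theta)\,e^{-\gamma x}w(x)x^{-\mu}I_{\mu+1}(x).\qquad( * )$$ In particular, for any positive nondecreasing slowly varying function $L$, the function $w(x)=x^qL(x)$ is a regularly varying weight of index $q$ for which $( * )$ holds with the same constant $M_{\mu,q,\gamma}(\theta)$. (b) More generally, let $L$ be positive and absolutely continuous on $(0,\infty)$ with $$\frac{L'(x)}{L(x)}\ge-\eta\quad\text{for a.e. }x>0,\qquad 0\le\eta<1-\gamma,$$ and set $w(x)=x^qL(x)$. Then $w\in\mathcal A_q(\eta)$, and for every $\theta$ with $\gamma+\eta<\theta<1$ and all $x>0$, $$\int_0^x e^{-\gamma t}w(t)t^{-\mu}I_\mu(t)\,dt\le M^{(\eta)}_{\mu,q,\gamma}(\theta)\,e^{-\gamma x}w(x)x^{-\mu}I_{\mu+1}(x).$$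
   Context: $I_\alpha(x)=\sum_{k=0}^{\infty}\frac{(x/2)^{2k+\alpha}}{k!\,\Gamma(k+\alpha+1)}$, $x>0$, is the modified Bessel function of the first kind. Absolute continuity on $(0,\infty)$ means absolute continuity on every compact subinterval. Slow/regular variation is at infinity. A positive, finite, measurable function $w$ on $(0,\infty)$ is an upper $q$-power weight if $w(x)x^{-q}$ is nondecreasing on $(0,\infty)$. For $\eta\ge0$, $w\in\mathcal A_q(\eta)$ means $w$ is positive, finite, measurable and $w(t)t^{-q}\le e^{\eta(x-t)}w(x)x^{-q}$ for all $0<t\le x<\infty$. For $\mu>-1$, $q>-1$, $0<\theta<1$: $K_{\mu,q}=\max\{1,\frac{2(\mu+1)}{q+1}\}$; $X_{\mu,q}(\theta)=\frac{2(\mu+2)\theta}{1-\theta}$ if $q\ge0$, and if $-1<q<0$, $$X_{\mu,q}(\theta)=\max\left\{\frac{2(\mu+2)\theta}{1-\theta},\ \frac{(2\mu+2)\theta-q+\sqrt{\{(2\mu+2)\theta-q\}^2-4(1-\theta)q(2\mu+2)}}{2(1-\theta)}\right\};$$ $\beta_{\mu,q}(\theta)=\frac{X_{\mu,q}(\theta)}{X_{\mu,q}(\theta)+2\mu+2}$; $M_{\mu,q,\gamma}(\theta)=\max\left\{K_{\mu,q}\exp(\gamma X_{\mu,q}(\theta)),\ \frac{1}{\beta_{\mu,q}(\theta)(\theta-\gamma)}\right\}$; $M^{(\eta)}_{\mu,q,\gamma}(\theta)=\max\left\{K_{\mu,q}\exp((\gamma+\eta)X_{\mu,q}(\theta)),\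 \frac{1}{\beta_{\mu,q}(\theta)(\theta-\gamma-\eta)}\right\}$. *)

theory Defs
  imports "HOL-Analysis.Analysis"
begin

definition bessel_I :: "real \<Rightarrow> real \<Rightarrow> real" where
  "bessel_I \<alpha> x =
     (\<Sum>k. (x / 2) powr (2 * real k + \<alpha>) / (fact k * Gamma (real k + \<alpha> + 1)))"

text \<open>
  Absolute continuity of a function on a compact interval \<open>[a,b]\<close>; the constant
  \<^const>\<open>absolutely_continuous\<close> of the library is a relation between measures. The finite set \<open>D\<close> holds
  the endpoint pairs of non-overlapping subintervals.
\<close>

definition abs_continuous_on_interval :: "real \<Rightarrow> real \<Rightarrow> (real \<Rightarrow> real) \<Rightarrow> bool" where
  "abs_continuous_on_interval a b f \<longleftrightarrow>
     (\<forall>\<epsilon>>0. \<exists>\<delta>>0. \<forall>D. finite D \<and> (\<forall>(u, v)\<in>D. a \<le> u \<and> u \<le> v \<and> v \<le> b) \<and>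
        disjoint_family_on (\<lambda>(u, v). {u<..<v}) D \<and> (\<Sum>(u, v)\<in>D. v - u) < \<delta>
        \<longrightarrow> (\<Sum>(u, v)\<in>D. \<bar>f v - f u\<bar>) < \<epsilon>)"

definition abs_continuous_on_pos :: "(real \<Rightarrow> real) \<Rightarrow> bool" where
  "abs_continuous_on_pos f \<longleftrightarrow> (\<forall>a b. 0 < a \<and> a \<le> b \<longrightarrow> abs_continuous_on_interval a b f)"

text \<open>
  Functions on \<open>(0,\<infinity>)\<close> are total functions on the reals whose values outside \<open>(0,\<infinity>)\<close> are never
  used. Finiteness is built into the type, and measurability is Lebesgue measurability.
\<close>

definition pos_measurable :: "(real \<Rightarrow> real) \<Rightarrow> bool" where
  "pos_measurable w \<longleftrightarrow> (\<forall>x>0. 0 < w x) \<and> w \<in> borel_measurable (lebesgue_on {0<..})"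

definition upper_power_weight :: "real \<Rightarrow> (real \<Rightarrow> real) \<Rightarrow> bool" where
  "upper_power_weight q w \<longleftrightarrow> pos_measurable w \<and> mono_on {0<..} (\<lambda>x. w x * x powr (- q))"

definition weight_class :: "real \<Rightarrow> real \<Rightarrow> (real \<Rightarrow> real) set" where
  "weight_class q \<eta> = {w. pos_measurable w \<and>
     (\<forall>t x. 0 < t \<and> t \<le> x \<longrightarrow> w t * t powr (- q) \<le> exp (\<eta> * (x - t)) * (w x * x powr (- q)))}"

definition regularly_varying :: "real \<Rightarrow> (real \<Rightarrow> real) \<Rightarrow> bool" where
  "regularly_varying \<rho> f \<longleftrightarrow> pos_measurable f \<and>
     (\<forall>c>0. ((\<lambda>x. f (c * x) / f x) \<longlongrightarrow> c powr \<rho>) at_top)"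

definition slowly_varying :: "(real \<Rightarrow> real) \<Rightarrow> bool" where
  "slowly_varying f \<longleftrightarrow> pos_measurable f \<and>
     (\<forall>c>0. ((\<lambda>x. f (c * x) / f x) \<longlongrightarrow> 1) at_top)"

definition K_const :: "real \<Rightarrow> real \<Rightarrow> real" where
  "K_const \<mu> q = max 1 (2 * (\<mu> + 1) / (q + 1))"

definition X_const :: "real \<Rightarrow> real \<Rightarrow> real \<Rightarrow> real" where
  "X_const \<mu> q \<theta> =
     (if q \<ge> 0 then 2 * (\<mu> + 2) * \<theta> / (1 - \<theta>)
      else max (2 * (\<mu> + 2) * \<theta> / (1 - \<theta>))
               (((2 * \<mu> + 2) * \<theta> - q +
                 sqrt (((2 * \<mu> + 2) * \<theta> - q)\<^sup>2 - 4 * (1 - \<theta>) * q * (2 * \<mu> + 2)))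
                / (2 * (1 - \<theta>))))"

definition beta_const :: "real \<Rightarrow> real \<Rightarrow> real \<Rightarrow> real" where
  "beta_const \<mu> q \<theta> = X_const \<mu> q \<theta> / (X_const \<mu> q \<theta> + 2 * \<mu> + 2)"

definition M_const :: "real \<Rightarrow> real \<Rightarrow> real \<Rightarrow> real \<Rightarrow> real" where
  "M_const \<mu> q \<gamma> \<theta> =
     max (K_const \<mu> q * exp (\<gamma> * X_const \<mu> q \<theta>))
         (1 / (beta_const \<mu> q \<theta> * (\<theta> - \<gamma>)))"

definition M_eta_const :: "real \<Rightarrow> real \<Rightarrow> real \<Rightarrow> real \<Rightarrow> real \<Rightarrow> real" where
  "M_eta_const \<eta> \<mu> q \<gamma> \<theta> =
     max (K_const \<mu> q * exp ((\<gamma> + \<eta>) * X_const \<mu> q \<theta>))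
         (1 / (beta_const \<mu> q \<theta> * (\<theta> - \<gamma> - \<eta>)))"

text \<open>
  The weighted integral inequality with constant \<open>C\<close>. Its left-hand side has a nonnegative integrand
  and the bound asserts that it is finite; since the Bochner integral of a non-integrable function
  is \<open>0\<close>, integrability is stated explicitly.
\<close>

definition bessel_integral_bound :: "real \<Rightarrow> real \<Rightarrow> (real \<Rightarrow> real) \<Rightarrow> real \<Rightarrow> bool" where
  "bessel_integral_bound \<mu> \<gamma> w C \<longleftrightarrow> (\<forall>x>0.
     set_integrable lebesgue {0<..<x} (\<lambda>t. exp (- \<gamma> * t) * w t * t powr (- \<mu>) * bessel_I \<mu> t) \<and>
     (LINT t:{0<..<x}|lebesgue. exp (- \<gamma> * t) * w t * t powr (- \<mu>) * bessel_I \<mu> t)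
       \<le> C * (exp (- \<gamma> * x) * w x * x powr (- \<mu>) * bessel_I (\<mu> + 1) x))"

text \<open>
  An inequality for \<open>f'\<close> almost everywhere includes the existence of \<open>f'\<close> almost everywhere. For an
  absolutely continuous \<open>f\<close> the latter is automatic; it is spelled out because \<^const>\<open>deriv\<close> has an
  unspecified value where \<open>f\<close> is not differentiable.
\<close>

definition log_deriv_ge_ae :: "(real \<Rightarrow> real) \<Rightarrow> real \<Rightarrow> bool" where
  "log_deriv_ge_ae f c \<longleftrightarrow>
     (AE x in lebesgue. 0 < x \<longrightarrow> f differentiable (at x) \<and> deriv f x / f x \<ge> c)"

end

theory Submission
  imports Defs
begin

text \<open>
  Write \<open>f(t) = t\<^bsup>-\<mu>\<^esup> I\<^sub>\<mu>(t)\<close> and \<open>g(t) = t\<^bsup>-\<mu>\<^esup> I\<^bsub>\<mu>+1\<^esub>(t)\<close>. A weight in the class \<open>\<A>\<^sub>q(\<eta>)\<close> satisfies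
  \<open>w(t) \<le> t\<^sup>q e\<^bsup>\<eta>(x-t)\<^esup> w(x) x\<^bsup>-q\<^esup>\<close> for \<open>t \<le> x\<close>, so everything reduces to the pure power weight: with
  \<open>\<delta> = \<gamma> + \<eta>\<close>, the integral of \<open>e\<^bsup>-\<delta>t\<^esup> t\<^sup>q f(t)\<close> over \<open>[0,x]\<close> must be at most a constant times
  \<open>\<Psi>(x) = e\<^bsup>-\<delta>x\<^esup> x\<^sup>q g(x)\<close> (lemma \<open>bessel_kernel_integral_bound\<close>). This is shown by comparing the integrand with a multiple of
  the derivative of \<open>\<Psi>\<close>, in two regimes separated by the point \<open>X\<close> of the statement.

  Up to \<open>X\<close> the damping is ignored: \<open>t\<^sup>q f(t) \<le> K (t\<^sup>q g(t))'\<close> follows from the recurrence for the Bessel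
  functions, and restoring the damping costs at most \<open>e\<^bsup>\<delta>X\<^esup>\<close>. Beyond \<open>X\<close> the lower bound
  \<open>I\<^bsub>\<nu>+1\<^esub>(t)/I\<^sub>\<nu>(t) \<ge> t/(t + 2\<nu> + 2)\<close> (lemma \<open>bessel_clifford_ratio_bound\<close>) is used twice: with \<open>\<nu> = \<mu> + 1\<close> it
  makes \<open>t\<^sup>q g(t)\<close> grow at logarithmic rate at least \<open>\<theta> > \<delta>\<close>, and with \<open>\<nu> = \<mu>\<close> it gives \<open>g \<ge> \<beta> f\<close>. Hence
  \<open>\<Psi>'(t) \<ge> \<beta> (\<theta> - \<delta>) e\<^bsup>-\<delta>t\<^esup> t\<^sup>q f(t)\<close> there. The ratio bound itself comes from the monotonicity of \<open>I\<^sub>\<nu>\<close> in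
  the index.

  It remains to place the weights \<open>x\<^sup>q L(x)\<close> in the class. For nondecreasing \<open>L\<close> this is immediate with
  \<open>\<eta> = 0\<close>. For absolutely continuous \<open>L\<close> with \<open>L'/L \<ge> -\<eta>\<close> almost everywhere it says that \<open>e\<^bsup>\<eta>x\<^esup> L(x)\<close> is
  nondecreasing, an instance of the fact that an absolutely continuous function with nonnegative
  derivative almost everywhere is nondecreasing (lemma \<open>abs_continuous_deriv_nonneg_AE_imp_le\<close>).
\<close>

section \<open>The Bessel-Clifford function\<close>

definition clifford_coeff :: "real \<Rightarrow> nat \<Rightarrow> real" where
  "clifford_coeff \<nu> k = 1 / (fact k * Gamma (real k + \<nu> + 1))"

text \<open>
  This is the Bessel-Clifford function: \<open>I\<^sub>\<nu> x = (x/2)\<^sup>\<nu> C\<^sub>\<nu> (x\<^sup>2/4)\<close> for \<open>x > 0\<close>. Unlike \<open>I\<^sub>\<nu>\<close> it is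
  given by an ordinary power series, hence smooth at the origin, and differentiation
  just raises the index.
\<close>

definition bessel_clifford :: "real \<Rightarrow> real \<Rightarrow> real" where
  "bessel_clifford \<nu> y = (\<Sum>k. clifford_coeff \<nu> k * y ^ k)"

lemma clifford_coeff_pos: "\<nu> > -1 \<Longrightarrow> clifford_coeff \<nu> k > 0"
  by (auto simp: clifford_coeff_def intro!: divide_pos_pos mult_pos_pos Gamma_real_pos)

lemma clifford_coeff_Suc:
  assumes "\<nu> > -1"
  shows "clifford_coeff \<nu> (Suc k) = clifford_coeff \<nu> k / (real (Suc k) * (real k + \<nu> + 1))"
proof -
  have "Gamma ((real k + \<nu> + 1) + 1) = (real k + \<nu> + 1) * Gamma (real k + \<nu> + 1)"
    using assms by (intro Gamma_plus1) (auto elim!: nonpos_Ints_cases)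
  then show ?thesis
    by (simp add: clifford_coeff_def algebra_simps)
qed

lemma diffs_clifford_coeff: "diffs (clifford_coeff \<nu>) = clifford_coeff (\<nu> + 1)"
proof
  fix k
  have "real (Suc k) + \<nu> + 1 = real k + (\<nu> + 1) + 1"
    by simp
  then show "diffs (clifford_coeff \<nu>) k = clifford_coeff (\<nu> + 1) k"
    by (simp only: diffs_def clifford_coeff_def fact_Suc) (simp del: of_nat_Suc)
qed

lemma clifford_coeff_recurrence:
  assumes "\<nu> > -1"
  shows "clifford_coeff \<nu> k = (real k + \<nu> + 1) * clifford_coeff (\<nu> + 1) k"
proof -
  have "Gamma ((real k + \<nu> + 1) + 1) = (real k + \<nu> + 1) * Gamma (real k + \<nu> + 1)"
    using assms by (intro Gamma_plus1) (auto elim!: nonpos_Ints_cases)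
  moreover have "real k + \<nu> + 1 \<noteq> 0"
    using assms by linarith
  ultimately show ?thesis
    by (simp add: clifford_coeff_def add_ac)
qed

lemma summable_bessel_clifford:
  assumes "\<nu> > -1"
  shows "summable (\<lambda>k. clifford_coeff \<nu> k * y ^ k)"
proof (rule summable_ratio_test)
  show "(1/2 :: real) < 1" by simp
  \<comment> \<open>From \<open>k \<ge> 2|y|\<close> on, consecutive terms have ratio at most \<open>1/2\<close>; \<open>k \<ge> 1\<close> ensures \<open>k + \<nu> + 1 \<ge> 1\<close>.\<close>
  fix k assume k: "max 1 (nat \<lceil>2 * \<bar>y\<bar>\<rceil>) \<le> k"
  have "2 * \<bar>y\<bar> \<le> real k" using k by linarith
  also have "\<dots> \<le> real (Suc k) * (real k + \<nu> + 1)"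
  proof -
    have "real k * 1 \<le> real (Suc k) * (real k + \<nu> + 1)"
      using k assms by (intro mult_mono) auto
    then show ?thesis by simp
  qed
  finally have *: "\<bar>y\<bar> \<le> (real (Suc k) * (real k + \<nu> + 1)) / 2"
    by simp
  have pos: "real (Suc k) * (real k + \<nu> + 1) > 0"
    using assms by (intro mult_pos_pos) linarith+
  have "norm (clifford_coeff \<nu> (Suc k) * y ^ Suc k)
      = (\<bar>y\<bar> / (real (Suc k) * (real k + \<nu> + 1))) * norm (clifford_coeff \<nu> k * y ^ k)"
    using pos k assms unfolding clifford_coeff_Suc[OF assms] by (simp add: abs_mult power_abs)
  also have "\<dots> \<le> (1/2) * norm (clifford_coeff \<nu> k * y ^ k)"
    using * pos by (intro mult_right_mono) (auto simp: field_simps)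
  finally show "norm (clifford_coeff \<nu> (Suc k) * y ^ Suc k)
      \<le> (1/2) * norm (clifford_coeff \<nu> k * y ^ k)" .
qed

lemma DERIV_bessel_clifford:
  assumes "\<nu> > -1"
  shows "(bessel_clifford \<nu> has_real_derivative bessel_clifford (\<nu> + 1) y) (at y)"
  using termdiffs_strong_converges_everywhere[OF summable_bessel_clifford[OF assms], of y]
  unfolding bessel_clifford_def diffs_clifford_coeff .

lemma DERIV_bessel_clifford_square:
  assumes "\<nu> > -1"
  shows "((\<lambda>x. bessel_clifford \<nu> (x\<^sup>2 / 4)) has_real_derivative
           x / 2 * bessel_clifford (\<nu> + 1) (x\<^sup>2 / 4)) (at x)"
proof -
  have "((\<lambda>x. x\<^sup>2 / 4) has_real_derivative x / 2) (at x)"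
    by (auto intro!: derivative_eq_intros)
  from DERIV_chain2[OF DERIV_bessel_clifford[OF assms] this] show ?thesis
    by (simp add: mult.commute)
qed

lemma continuous_on_bessel_clifford [continuous_intros]:
  assumes "\<nu> > -1" "continuous_on S f"
  shows "continuous_on S (\<lambda>x. bessel_clifford \<nu> (f x))"
proof -
  have "continuous_on UNIV (bessel_clifford \<nu>)"
    using DERIV_bessel_clifford[OF assms(1)] DERIV_isCont continuous_at_imp_continuous_on by blast
  then show ?thesis
    using assms(2) continuous_on_compose2 by blast
qed

lemma bessel_clifford_pos:
  assumes "\<nu> > -1" "y \<ge> 0"
  shows "bessel_clifford \<nu> y > 0"
  unfolding bessel_clifford_def
  by (rule suminf_pos2[where i = 0])
     (use assms clifford_coeff_pos[of \<nu>] in \<open>auto intro!: summable_bessel_clifford simp: less_imp_le\<close>)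

text \<open>
  The power series form of \<open>I\<^sub>\<nu> = I\<^bsub>\<nu>+2\<^esub> + (2(\<nu>+1)/x) I\<^bsub>\<nu>+1\<^esub>\<close>. Coefficientwise, \<open>\<Gamma>(z+1) = z \<Gamma>(z)\<close> turns
  the coefficients of index \<open>\<nu>\<close> into \<open>k + \<nu> + 1\<close> times those of index \<open>\<nu> + 1\<close>; the factor \<open>k\<close> is a
  derivative, which raises the index once more.
\<close>

lemma bessel_clifford_recurrence:
  assumes "\<nu> > -1"
  shows "bessel_clifford \<nu> y = (\<nu> + 1) * bessel_clifford (\<nu> + 1) y + y * bessel_clifford (\<nu> + 2) y"
proof -
  let ?c = "clifford_coeff (\<nu> + 1)"
  have s: "summable (\<lambda>k. ?c k * y ^ k)"
    using assms by (intro summable_bessel_clifford) simp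
  have s2: "summable (\<lambda>k. clifford_coeff (\<nu> + 1 + 1) k * y ^ k)"
    using assms by (intro summable_bessel_clifford) simp
  have shift: "real (Suc k) * ?c (Suc k) * y ^ Suc k = y * (clifford_coeff (\<nu> + 1 + 1) k * y ^ k)" for k
    using fun_cong[OF diffs_clifford_coeff[of "\<nu> + 1"], of k] by (simp add: diffs_def del: of_nat_Suc)
  have s3: "summable (\<lambda>k. real k * ?c k * y ^ k)"
    using summable_mult[OF s2, of y] unfolding shift[symmetric] summable_Suc_iff[of "\<lambda>k. real k * ?c k * y ^ k"] .
  have "bessel_clifford \<nu> y = (\<Sum>k. (\<nu> + 1) * (?c k * y ^ k) + real k * ?c k * y ^ k)"
    unfolding bessel_clifford_def clifford_coeff_recurrence[OF assms] by (simp add: algebra_simps)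
  also have "\<dots> = (\<nu> + 1) * bessel_clifford (\<nu> + 1) y + (\<Sum>k. real k * ?c k * y ^ k)"
    unfolding bessel_clifford_def using s s3 by (simp add: suminf_add[symmetric] suminf_mult summable_mult)
  also have "(\<Sum>k. real k * ?c k * y ^ k) = y * bessel_clifford (\<nu> + 1 + 1) y"
    using suminf_split_head[OF s3] s2 unfolding shift bessel_clifford_def by (simp add: suminf_mult)
  finally show ?thesis
    by (simp add: add.assoc)
qed

lemma bessel_I_eq_clifford:
  assumes "\<nu> > -1" "x > 0"
  shows "bessel_I \<nu> x = (x / 2) powr \<nu> * bessel_clifford \<nu> (x\<^sup>2 / 4)"
proof -
  have "(x / 2) powr (2 * real k + \<nu>) / (fact k * Gamma (real k + \<nu> + 1)) =
      (x / 2) powr \<nu> * (clifford_coeff \<nu> k * (x\<^sup>2 / 4) ^ k)" for k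
  proof -
    have "(x / 2) powr (2 * real k) = ((x / 2) ^ 2) ^ k"
      using assms by (simp add: powr_realpow[symmetric] powr_powr mult_ac flip: powr_numeral)
    also have "\<dots> = (x\<^sup>2 / 4) ^ k" by (simp add: power_divide)
    finally show ?thesis by (simp add: powr_add clifford_coeff_def)
  qed
  then show ?thesis
    unfolding bessel_I_def bessel_clifford_def
    using summable_bessel_clifford[OF assms(1), of "x\<^sup>2/4"] by (simp add: suminf_mult)
qed

text \<open>
  In Bessel terms, \<open>I\<^bsub>\<nu>+1\<^esub> \<le> I\<^sub>\<nu>\<close>. The difference \<open>d\<close> of the two sides satisfies
  \<open>d' + d = (\<nu> + 1/2) C\<^bsub>\<nu>+1\<^esub> \<ge> 0\<close>, so \<open>e\<^sup>x d(x)\<close> increases from its positive value at \<open>0\<close>.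
\<close>

lemma bessel_clifford_decreasing_in_index:
  assumes "\<nu> \<ge> -1/2" "x \<ge> 0"
  shows "x / 2 * bessel_clifford (\<nu> + 1) (x\<^sup>2 / 4) \<le> bessel_clifford \<nu> (x\<^sup>2 / 4)"
proof -
  define h where "h x = exp x * (bessel_clifford \<nu> (x\<^sup>2 / 4) - x / 2 * bessel_clifford (\<nu> + 1) (x\<^sup>2 / 4))" for x
  have "h 0 \<le> h x"
  proof (rule DERIV_nonneg_imp_nondecreasing[OF \<open>x \<ge> 0\<close>])
    fix t :: real assume "0 \<le> t"
    have "(h has_real_derivative exp t * ((\<nu> + 1/2) * bessel_clifford (\<nu> + 1) (t\<^sup>2 / 4))) (at t)"
    proof -
      note d = DERIV_bessel_clifford_square[of \<nu> t] DERIV_bessel_clifford_square[of "\<nu> + 1" t]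
      have \<nu>: "\<nu> > -1" using assms by simp
      show ?thesis
        unfolding h_def
        by (rule derivative_eq_intros d refl | use \<nu> in simp; fail)+
           (simp add: bessel_clifford_recurrence[OF \<nu>] algebra_simps power2_eq_square)
    qed
    moreover have "exp t * ((\<nu> + 1/2) * bessel_clifford (\<nu> + 1) (t\<^sup>2 / 4)) \<ge> 0"
      using assms by (intro mult_nonneg_nonneg less_imp_le[OF bessel_clifford_pos]) auto
    ultimately show "\<exists>y. (h has_real_derivative y) (at t) \<and> 0 \<le> y" by blast
  qed
  moreover have "h 0 > 0"
    using bessel_clifford_pos[of \<nu> 0] assms by (simp add: h_def)
  ultimately have "0 < h x" by linarith
  then show ?thesis by (simp add: h_def zero_less_mult_iff)
qed

text \<open>
  In Bessel terms, \<open>I\<^bsub>\<nu>+1\<^esub>(x) / I\<^sub>\<nu>(x) \<ge> x / (x + 2\<nu> + 2)\<close>, the one Bessel inequality behind the whole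
  result. It is the comparison of the indices \<open>\<nu> + 1\<close> and \<open>\<nu> + 2\<close>, inserted into the recurrence;
  this shift of index is why it holds down to \<open>\<nu> = -1\<close>.
\<close>

lemma bessel_clifford_ratio_bound:
  assumes "\<nu> > -1" "x \<ge> 0"
  shows "bessel_clifford \<nu> (x\<^sup>2 / 4) \<le> (x / 2 + \<nu> + 1) * bessel_clifford (\<nu> + 1) (x\<^sup>2 / 4)"
proof -
  have "x / 2 * (x / 2 * bessel_clifford (\<nu> + 2) (x\<^sup>2 / 4)) \<le> x / 2 * bessel_clifford (\<nu> + 1) (x\<^sup>2 / 4)"
    using bessel_clifford_decreasing_in_index[of "\<nu> + 1" x] assms by (intro mult_left_mono) (auto simp: add_ac)
  then show ?thesis
    by (subst bessel_clifford_recurrence[OF assms(1)]) (simp add: algebra_simps power2_eq_square)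
qed

section \<open>Integrals bounded by a primitive\<close>

text \<open>
  The tool for bounding all integrals below: no integral is computed, a primitive of something
  larger is exhibited. Only continuity of the primitive is required at the endpoints, because at \<open>0\<close>
  the integrand may behave like \<open>t\<^sup>q\<close> with negative \<open>q\<close>.
\<close>

lemma integral_le_of_deriv_ge:
  fixes F F' \<phi> :: "real \<Rightarrow> real"
  assumes "a \<le> b" and F: "continuous_on {a..b} F"
    and F': "\<And>t. a < t \<Longrightarrow> t < b \<Longrightarrow> (F has_real_derivative F' t) (at t)"
    and cont: "continuous_on {a<..<b} \<phi>"
    and le: "\<And>t. a < t \<Longrightarrow> t < b \<Longrightarrow> 0 \<le> \<phi> t \<and> \<phi> t \<le> F' t"
  shows "\<phi> integrable_on {a..b}" and "integral {a..b} \<phi> \<le> F b - F a"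
proof -
  have "(F' has_integral F b - F a) {a..b}"
    using F' by (intro fundamental_theorem_of_calculus_interior[OF \<open>a \<le> b\<close> F])
                (auto simp: has_real_derivative_iff_has_vector_derivative[symmetric])
  then have int: "(F' has_integral F b - F a) {a<..<b}"
    by (simp add: has_integral_Icc_iff_Ioo)
  have "\<phi> absolutely_integrable_on {a<..<b}"
    using le by (intro measurable_bounded_by_integrable_imp_absolutely_integrable[OF
          continuous_imp_measurable_on_sets_lebesgue[OF cont] _ has_integral_integrable[OF int]]) auto
  then have \<phi>: "\<phi> integrable_on {a<..<b}"
    by (rule set_lebesgue_integral_eq_integral(1))
  then show "\<phi> integrable_on {a..b}"
    by (simp add: integrable_on_Icc_iff_Ioo)
  have "integral {a<..<b} \<phi> \<le> F b - F a"
    by (rule has_integral_le[OF integrable_integral[OF \<phi>] int]) (use le in auto)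
  then show "integral {a..b} \<phi> \<le> F b - F a"
    by (simp add: integral_open_interval_real)
qed

section \<open>The integral of the pure power weight\<close>

text \<open>
  Up to the constant factor \<open>2\<^sup>\<mu>\<close> this is the integrand \<open>e\<^bsup>-\<delta>t\<^esup> t\<^bsup>q-\<mu>\<^esup> I\<^sub>\<mu>(t)\<close>, and \<open>majorant\<close> below is the
  expression \<open>e\<^bsup>-\<delta>t\<^esup> t\<^bsup>q-\<mu>\<^esup> I\<^bsub>\<mu>+1\<^esub>(t)\<close> that is to bound its integral. The exponent \<open>q + 1 > 0\<close> in the latter
  makes it continuous at \<open>0\<close> with value \<open>0\<close>.
\<close>

definition bessel_kernel :: "real \<Rightarrow> real \<Rightarrow> real \<Rightarrow> real \<Rightarrow> real" where
  "bessel_kernel \<mu> q \<delta> t = exp (- \<delta> * t) * t powr q * bessel_clifford \<mu> (t\<^sup>2 / 4)"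

definition majorant :: "real \<Rightarrow> real \<Rightarrow> real \<Rightarrow> real \<Rightarrow> real" where
  "majorant \<mu> q \<delta> t = exp (- \<delta> * t) * t powr (q + 1) * bessel_clifford (\<mu> + 1) (t\<^sup>2 / 4) / 2"

definition majorant_deriv :: "real \<Rightarrow> real \<Rightarrow> real \<Rightarrow> real \<Rightarrow> real" where
  "majorant_deriv \<mu> q \<delta> t = exp (- \<delta> * t) * t powr q *
     ((q + 1) / 2 * bessel_clifford (\<mu> + 1) (t\<^sup>2 / 4) + t\<^sup>2 / 4 * bessel_clifford (\<mu> + 2) (t\<^sup>2 / 4)
      - \<delta> * (t / 2 * bessel_clifford (\<mu> + 1) (t\<^sup>2 / 4)))"

lemma DERIV_majorant:
  assumes "\<mu> > -1" "t > 0"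
  shows "(majorant \<mu> q \<delta> has_real_derivative majorant_deriv \<mu> q \<delta> t) (at t)"
proof -
  have bc: "((\<lambda>t. bessel_clifford (\<mu> + 1) (t\<^sup>2 / 4)) has_real_derivative
      t / 2 * bessel_clifford (\<mu> + 2) (t\<^sup>2 / 4)) (at t)"
    using DERIV_bessel_clifford_square[of "\<mu> + 1" t] assms by (simp add: add.assoc)
  have pw: "((\<lambda>t. t powr (q + 1)) has_real_derivative (q + 1) * t powr q) (at t)"
    using has_real_derivative_powr[OF \<open>t > 0\<close>, of "q + 1"] by simp
  have ex: "((\<lambda>t. exp (- \<delta> * t)) has_real_derivative - \<delta> * exp (- \<delta> * t)) (at t)"
    by (auto intro!: derivative_eq_intros)
  have [simp]: "t powr (q + 1) = t * t powr q" "t powr (1 + q) = t * t powr q"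
    using \<open>t > 0\<close> by (simp_all add: powr_add)
  show ?thesis
    unfolding majorant_def[abs_def] majorant_deriv_def
    by (rule DERIV_cong[OF DERIV_cdivide[OF DERIV_mult[OF DERIV_mult[OF ex pw] bc]]])
       (simp add: field_simps power2_eq_square)
qed

lemma continuous_on_majorant:
  assumes "\<mu> > -1" "q > -1" "S \<subseteq> {0..}"
  shows "continuous_on S (majorant \<mu> q \<delta>)"
  unfolding majorant_def[abs_def]
  by (intro continuous_intros continuous_on_powr') (use assms in auto)

lemma continuous_on_bessel_kernel:
  assumes "\<mu> > -1" "S \<subseteq> {0<..}"
  shows "continuous_on S (bessel_kernel \<mu> q \<delta>)"
  unfolding bessel_kernel_def[abs_def]
  by (intro continuous_intros) (use assms in auto)

lemma bessel_kernel_nonneg: "\<mu> > -1 \<Longrightarrow> 0 \<le> bessel_kernel \<mu> q \<delta> t"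
  using bessel_clifford_pos[of \<mu> "t\<^sup>2 / 4"] by (simp add: bessel_kernel_def less_imp_le)

lemma majorant_nonneg: "\<mu> > -1 \<Longrightarrow> 0 \<le> majorant \<mu> q \<delta> t"
  using bessel_clifford_pos[of "\<mu> + 1" "t\<^sup>2 / 4"] by (simp add: majorant_def less_imp_le)

lemma bessel_kernel_antimono:
  assumes "\<mu> > -1" "0 \<le> \<delta>" "0 \<le> t"
  shows "bessel_kernel \<mu> q \<delta> t \<le> bessel_kernel \<mu> q 0 t"
  unfolding bessel_kernel_def using assms bessel_clifford_pos[of \<mu> "t\<^sup>2 / 4"]
  by (intro mult_right_mono) auto

lemma K_const_ge:
  assumes "q > -1"
  shows "1 \<le> K_const \<mu> q" "2 * (\<mu> + 1) \<le> K_const \<mu> q * (q + 1)"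
proof -
  show "1 \<le> K_const \<mu> q" by (simp add: K_const_def)
  have "2 * (\<mu> + 1) / (q + 1) \<le> K_const \<mu> q" by (simp add: K_const_def)
  then show "2 * (\<mu> + 1) \<le> K_const \<mu> q * (q + 1)"
    using assms by (simp add: divide_le_eq)
qed

lemma X_const_ge: "2 * (\<mu> + 2) * \<theta> / (1 - \<theta>) \<le> X_const \<mu> q \<theta>"
  by (simp add: X_const_def)

text \<open>
  After the recurrence is applied to \<open>C\<^sub>\<mu>\<close>, both sides are combinations of \<open>C\<^bsub>\<mu>+1\<^esub>\<close> and \<open>C\<^bsub>\<mu>+2\<^esub>\<close>; the two
  coefficient comparisons are exactly the two entries of the maximum that defines \<open>K_const\<close>.
\<close>

lemma bessel_kernel_le_majorant_deriv_undamped: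
  assumes \<mu>: "\<mu> > -1" and q: "q > -1"
  shows "bessel_kernel \<mu> q 0 t \<le> K_const \<mu> q * majorant_deriv \<mu> q 0 t"
proof -
  let ?A = "\<lambda>\<nu>. bessel_clifford \<nu> (t\<^sup>2 / 4)"
  have pos: "0 < ?A (\<mu> + 1)" "0 < ?A (\<mu> + 2)"
    using \<mu> by (auto intro!: bessel_clifford_pos)
  have "?A \<mu> = (\<mu> + 1) * ?A (\<mu> + 1) + t\<^sup>2 / 4 * ?A (\<mu> + 2)"
    by (rule bessel_clifford_recurrence[OF \<mu>])
  also have "\<dots> \<le> (K_const \<mu> q * (q + 1) / 2) * ?A (\<mu> + 1) + K_const \<mu> q * (t\<^sup>2 / 4 * ?A (\<mu> + 2))"
  proof (rule add_mono)
    show "(\<mu> + 1) * ?A (\<mu> + 1) \<le> (K_const \<mu> q * (q + 1) / 2) * ?A (\<mu> + 1)"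
      using K_const_ge(2)[OF q, of \<mu>] pos by (intro mult_right_mono) auto
    show "t\<^sup>2 / 4 * ?A (\<mu> + 2) \<le> K_const \<mu> q * (t\<^sup>2 / 4 * ?A (\<mu> + 2))"
      using K_const_ge(1)[OF q, of \<mu>] pos
        mult_right_mono[of 1 "K_const \<mu> q" "t\<^sup>2 / 4 * ?A (\<mu> + 2)"] by simp
  qed
  finally have *: "?A \<mu> \<le> K_const \<mu> q * ((q + 1) / 2 * ?A (\<mu> + 1) + t\<^sup>2 / 4 * ?A (\<mu> + 2))"
    by (simp add: algebra_simps)
  show ?thesis
    using mult_left_mono[OF *, of "t powr q"] by (simp add: bessel_kernel_def majorant_deriv_def mult_ac)
qed

text \<open>
  The logarithmic derivative of \<open>t\<^bsup>q-\<mu>\<^esup> I\<^bsub>\<mu>+1\<^esub>(t)\<close> is \<open>(q + 1)/t + I\<^bsub>\<mu>+2\<^esub>(t)/I\<^bsub>\<mu>+1\<^esub>(t)\<close>. The ratio bound with index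
  \<open>\<mu> + 1\<close> makes it at least \<open>\<theta>\<close> as soon as \<open>t \<ge> 2(\<mu>+2)\<theta>/(1-\<theta>)\<close>, so the damping \<open>e\<^bsup>-\<delta>t\<^esup>\<close> leaves the rate
  \<open>\<theta> - \<delta>\<close>. The ratio bound with index \<open>\<mu>\<close> then converts \<open>I\<^bsub>\<mu>+1\<^esub>\<close> into \<open>I\<^sub>\<mu>\<close> at the cost of the factor
  \<open>X / (X + 2\<mu> + 2)\<close>, the value at \<open>X\<close> of the increasing function \<open>t / (t + 2\<mu> + 2)\<close>.
\<close>

lemma bessel_kernel_le_majorant_deriv_damped:
  assumes \<mu>: "\<mu> > -1" and q: "q > -1" and \<theta>: "\<delta> < \<theta>" "\<theta> < 1"
    and X: "0 < X" "2 * (\<mu> + 2) * \<theta> / (1 - \<theta>) \<le> X" "X \<le> t"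
  shows "X / (X + 2 * \<mu> + 2) * (\<theta> - \<delta>) * bessel_kernel \<mu> q \<delta> t \<le> majorant_deriv \<mu> q \<delta> t"
proof -
  let ?A = "\<lambda>\<nu>. bessel_clifford \<nu> (t\<^sup>2 / 4)"
  define \<beta> where "\<beta> = X / (X + 2 * \<mu> + 2)"
  have t: "0 < t" using X by simp
  have pos: "0 < ?A (\<mu> + 1)" "0 < ?A (\<mu> + 2)"
    using \<mu> by (auto intro!: bessel_clifford_pos)
  have "0 \<le> \<beta>" using X \<mu> by (simp add: \<beta>_def)
  \<comment> \<open>This yields the rate \<open>\<theta>\<close>; the other summand \<open>(q + 1)/t\<close> of the logarithmic derivative is positive.\<close>
  have log_deriv: "\<theta> * ?A (\<mu> + 1) \<le> t / 2 * ?A (\<mu> + 2)"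
  proof (cases "0 \<le> \<theta>")
    case True
    have "2 * (\<mu> + 2) * \<theta> \<le> t * (1 - \<theta>)"
      using order_trans[OF X(2,3)] \<theta> by (simp add: divide_le_eq)
    then have "\<theta> * (t / 2 + \<mu> + 2) \<le> t / 2" by (simp add: field_simps)
    have "?A (\<mu> + 1) \<le> (t / 2 + \<mu> + 2) * ?A (\<mu> + 2)"
      using bessel_clifford_ratio_bound[of "\<mu> + 1" t] \<mu> t by (simp add: add.assoc)
    from mult_left_mono[OF this True]
    have "\<theta> * ?A (\<mu> + 1) \<le> \<theta> * (t / 2 + \<mu> + 2) * ?A (\<mu> + 2)" by (simp add: mult.assoc)
    also have "\<dots> \<le> t / 2 * ?A (\<mu> + 2)"
      using \<open>\<theta> * (t / 2 + \<mu> + 2) \<le> t / 2\<close> pos by (intro mult_right_mono) auto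
    finally show ?thesis .
  next
    case False
    \<comment> \<open>For negative \<open>\<theta>\<close> the two sides have opposite signs.\<close>
    then have "\<theta> * ?A (\<mu> + 1) \<le> 0" using pos by (simp add: mult_nonpos_nonneg)
    also have "0 \<le> t / 2 * ?A (\<mu> + 2)" using t pos by simp
    finally show ?thesis .
  qed
  have ratio: "\<beta> * ?A \<mu> \<le> t / 2 * ?A (\<mu> + 1)"
  proof -
    have "\<beta> * (t / 2 + \<mu> + 1) \<le> t / 2"
    proof -
      have "X * (\<mu> + 1) \<le> t * (\<mu> + 1)" using X \<mu> by (intro mult_right_mono) auto
      then show ?thesis using X \<mu> by (simp add: \<beta>_def field_simps)
    qed
    have "\<beta> * ?A \<mu> \<le> \<beta> * ((t / 2 + \<mu> + 1) * ?A (\<mu> + 1))"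
      using bessel_clifford_ratio_bound[of \<mu> t] \<mu> t \<open>0 \<le> \<beta>\<close> by (intro mult_left_mono) auto
    also have "\<dots> = \<beta> * (t / 2 + \<mu> + 1) * ?A (\<mu> + 1)" by simp
    also have "\<dots> \<le> t / 2 * ?A (\<mu> + 1)"
      using \<open>\<beta> * (t / 2 + \<mu> + 1) \<le> t / 2\<close> pos by (intro mult_right_mono) auto
    finally show ?thesis .
  qed
  have "\<beta> * (\<theta> - \<delta>) * ?A \<mu> = (\<theta> - \<delta>) * (\<beta> * ?A \<mu>)" by simp
  also have "\<dots> \<le> (\<theta> - \<delta>) * (t / 2 * ?A (\<mu> + 1))"
    using ratio \<theta> by (intro mult_left_mono) auto
  also have "\<dots> = t / 2 * (\<theta> * ?A (\<mu> + 1)) - \<delta> * (t / 2 * ?A (\<mu> + 1))"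
    by (simp only: left_diff_distrib mult.left_commute[of "t / 2"])
  also have "\<dots> \<le> t / 2 * (t / 2 * ?A (\<mu> + 2)) - \<delta> * (t / 2 * ?A (\<mu> + 1))"
    using log_deriv t by (intro diff_right_mono mult_left_mono) auto
  also have "\<dots> \<le> (q + 1) / 2 * ?A (\<mu> + 1) + t\<^sup>2 / 4 * ?A (\<mu> + 2) - \<delta> * (t / 2 * ?A (\<mu> + 1))"
    using q pos by (simp add: power2_eq_square)
  finally have *: "\<beta> * (\<theta> - \<delta>) * ?A \<mu> \<le> \<dots>" .
  show ?thesis
    using mult_left_mono[OF *, of "exp (- \<delta> * t) * t powr q"] unfolding \<beta>_def[symmetric]
    by (simp add: bessel_kernel_def majorant_deriv_def mult_ac)
qed

text \<open>
  Here the damping is discarded from the integrand and restored at the right endpoint, which costs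
  \<open>e\<^bsup>\<delta>x\<^esup>\<close>; this is affordable only for bounded \<open>x\<close>.
\<close>

lemma bessel_kernel_integral_undamped:
  assumes \<mu>: "\<mu> > -1" and q: "q > -1" and "0 \<le> \<delta>" "0 \<le> x"
  shows "bessel_kernel \<mu> q \<delta> integrable_on {0..x}"
    and "integral {0..x} (bessel_kernel \<mu> q \<delta>) \<le> K_const \<mu> q * exp (\<delta> * x) * majorant \<mu> q \<delta> x"
proof -
  let ?F = "\<lambda>t. K_const \<mu> q * majorant \<mu> q 0 t"
  have cont: "continuous_on {0..x} ?F"
    using \<mu> q by (intro continuous_intros continuous_on_majorant) auto
  have der: "(?F has_real_derivative K_const \<mu> q * majorant_deriv \<mu> q 0 t) (at t)" if "0 < t" for t
    by (rule DERIV_cmult[OF DERIV_majorant[OF \<mu> that]])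
  have bound: "0 \<le> bessel_kernel \<mu> q \<delta> t \<and> bessel_kernel \<mu> q \<delta> t \<le> K_const \<mu> q * majorant_deriv \<mu> q 0 t"
    if "0 < t" for t
    using bessel_kernel_nonneg[OF \<mu>] bessel_kernel_antimono[OF \<mu> \<open>0 \<le> \<delta>\<close>, of t q]
      bessel_kernel_le_majorant_deriv_undamped[OF \<mu> q, of t] that by (meson less_imp_le order_trans)
  have cont': "continuous_on {0<..<x} (bessel_kernel \<mu> q \<delta>)"
    by (rule continuous_on_bessel_kernel[OF \<mu>]) auto
  show "bessel_kernel \<mu> q \<delta> integrable_on {0..x}"
    by (rule integral_le_of_deriv_ge(1)[OF \<open>0 \<le> x\<close> cont der cont' bound])
  have "integral {0..x} (bessel_kernel \<mu> q \<delta>) \<le> ?F x - ?F 0"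
    by (rule integral_le_of_deriv_ge(2)[OF \<open>0 \<le> x\<close> cont der cont' bound])
  also have "\<dots> = K_const \<mu> q * exp (\<delta> * x) * majorant \<mu> q \<delta> x"
    by (simp add: majorant_def exp_minus)
  finally show "integral {0..x} (bessel_kernel \<mu> q \<delta>) \<le> K_const \<mu> q * exp (\<delta> * x) * majorant \<mu> q \<delta> x" .
qed

lemma bessel_kernel_integral_damped:
  assumes \<mu>: "\<mu> > -1" and q: "q > -1" and \<delta>: "0 \<le> \<delta>" and \<theta>: "\<delta> < \<theta>" "\<theta> < 1"
    and X: "0 < X" "2 * (\<mu> + 2) * \<theta> / (1 - \<theta>) \<le> X" "X \<le> x"
  shows "integral {X..x} (bessel_kernel \<mu> q \<delta>)
    \<le> 1 / (X / (X + 2 * \<mu> + 2) * (\<theta> - \<delta>)) * (majorant \<mu> q \<delta> x - majorant \<mu> q \<delta> X)"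
proof -
  define c where "c = X / (X + 2 * \<mu> + 2) * (\<theta> - \<delta>)"
  have "0 < c" unfolding c_def using X \<mu> \<theta> by (intro mult_pos_pos divide_pos_pos) auto
  let ?F = "\<lambda>t. 1 / c * majorant \<mu> q \<delta> t"
  have cont: "continuous_on {X..x} ?F"
    using \<mu> q X by (intro continuous_intros continuous_on_majorant) auto
  have der: "(?F has_real_derivative 1 / c * majorant_deriv \<mu> q \<delta> t) (at t)" if "X < t" for t
    by (rule DERIV_cmult[OF DERIV_majorant[OF \<mu>]]) (use X that in simp)
  have bound: "0 \<le> bessel_kernel \<mu> q \<delta> t \<and> bessel_kernel \<mu> q \<delta> t \<le> 1 / c * majorant_deriv \<mu> q \<delta> t"
    if "X < t" for t
  proof -
    have "c * bessel_kernel \<mu> q \<delta> t \<le> majorant_deriv \<mu> q \<delta> t"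
      unfolding c_def using that by (intro bessel_kernel_le_majorant_deriv_damped[OF \<mu> q \<theta> X(1,2)]) simp
    then show ?thesis
      using bessel_kernel_nonneg[OF \<mu>] \<open>0 < c\<close> by (simp add: field_simps)
  qed
  have cont': "continuous_on {X<..<x} (bessel_kernel \<mu> q \<delta>)"
    by (rule continuous_on_bessel_kernel[OF \<mu>]) (use X in auto)
  have "integral {X..x} (bessel_kernel \<mu> q \<delta>) \<le> ?F x - ?F X"
    by (rule integral_le_of_deriv_ge(2)[OF \<open>X \<le> x\<close> cont der cont' bound])
  then show ?thesis by (simp add: c_def right_diff_distrib)
qed

text \<open>
  The integral is split at \<open>X = X_const \<mu> q \<theta>\<close>. The undamped estimate applies up to \<open>X\<close>, the damped one
  beyond; the latter bounds the integral over \<open>[X,x]\<close> by an increment of the majorant, so the two parts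
  telescope and the constants combine to a maximum instead of a sum.
\<close>

lemma bessel_kernel_integral_bound:
  assumes \<mu>: "\<mu> > -1" and q: "q > -1" and \<delta>: "0 < \<delta>" and \<theta>: "\<delta> < \<theta>" "\<theta> < 1" and x: "0 < x"
  shows "integral {0..x} (bessel_kernel \<mu> q \<delta>) \<le> M_const \<mu> q \<delta> \<theta> * majorant \<mu> q \<delta> x"
proof -
  define X where "X = X_const \<mu> q \<theta>"
  have Xge: "2 * (\<mu> + 2) * \<theta> / (1 - \<theta>) \<le> X" unfolding X_def by (rule X_const_ge)
  moreover have "0 < 2 * (\<mu> + 2) * \<theta> / (1 - \<theta>)"
    using \<mu> \<delta> \<theta> by (intro divide_pos_pos mult_pos_pos) auto
  ultimately have "0 < X" by linarith
  define M1 where "M1 = K_const \<mu> q * exp (\<delta> * X)"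
  define M2 where "M2 = 1 / (X / (X + 2 * \<mu> + 2) * (\<theta> - \<delta>))"
  have M: "M_const \<mu> q \<delta> \<theta> = max M1 M2"
    by (simp add: M_const_def M1_def M2_def beta_const_def X_def)
  have small: "integral {0..y} (bessel_kernel \<mu> q \<delta>) \<le> M1 * majorant \<mu> q \<delta> y" if "0 \<le> y" "y \<le> X" for y
  proof -
    have "K_const \<mu> q * exp (\<delta> * y) \<le> M1"
      unfolding M1_def using that \<delta> K_const_ge(1)[OF q, of \<mu>] by (intro mult_left_mono) auto
    from mult_right_mono[OF this majorant_nonneg[OF \<mu>]] show ?thesis
      using bessel_kernel_integral_undamped(2)[OF \<mu> q less_imp_le[OF \<delta>] that(1)] order_trans by blast
  qed
  show ?thesis
  proof (cases "x \<le> X")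
    case True
    have "integral {0..x} (bessel_kernel \<mu> q \<delta>) \<le> M1 * majorant \<mu> q \<delta> x"
      using small[of x] x True by simp
    also have "\<dots> \<le> max M1 M2 * majorant \<mu> q \<delta> x"
      by (intro mult_right_mono majorant_nonneg[OF \<mu>]) auto
    finally show ?thesis by (simp add: M)
  next
    case False
    then have "X \<le> x" by simp
    have int: "bessel_kernel \<mu> q \<delta> integrable_on {0..x}"
      using bessel_kernel_integral_undamped(1)[OF \<mu> q] \<delta> x by simp
    have "0 < M2" unfolding M2_def using \<open>0 < X\<close> \<mu> \<theta> by (intro divide_pos_pos mult_pos_pos) auto
    have tail: "integral {X..x} (bessel_kernel \<mu> q \<delta>) \<le> M2 * (majorant \<mu> q \<delta> x - majorant \<mu> q \<delta> X)"
      unfolding M2_def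
      by (rule bessel_kernel_integral_damped[OF \<mu> q less_imp_le[OF \<delta>] \<theta> \<open>0 < X\<close> Xge \<open>X \<le> x\<close>])
    also have "\<dots> \<le> max M1 M2 * (majorant \<mu> q \<delta> x - majorant \<mu> q \<delta> X)"
    proof (rule mult_right_mono)
      \<comment> \<open>The increment of the majorant is nonnegative since it dominates an integral of a nonnegative function.\<close>
      have "0 \<le> integral {X..x} (bessel_kernel \<mu> q \<delta>)"
        by (rule integral_nonneg)
           (use bessel_kernel_nonneg[OF \<mu>] integrable_on_subinterval[OF int, of X x] \<open>0 < X\<close> in auto)
      with tail show "0 \<le> majorant \<mu> q \<delta> x - majorant \<mu> q \<delta> X"
        using \<open>0 < M2\<close> by (smt (verit) mult_pos_neg)
    qed simp
    finally have tail': "integral {X..x} (bessel_kernel \<mu> q \<delta>)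
        \<le> max M1 M2 * majorant \<mu> q \<delta> x - max M1 M2 * majorant \<mu> q \<delta> X"
      by (simp add: right_diff_distrib)
    have "integral {0..X} (bessel_kernel \<mu> q \<delta>) \<le> max M1 M2 * majorant \<mu> q \<delta> X"
      using small[of X] \<open>0 < X\<close> mult_right_mono[OF _ majorant_nonneg[OF \<mu>], of M1 "max M1 M2" q \<delta> X]
      by simp
    moreover have "integral {0..x} (bessel_kernel \<mu> q \<delta>)
        = integral {0..X} (bessel_kernel \<mu> q \<delta>) + integral {X..x} (bessel_kernel \<mu> q \<delta>)"
      using \<open>0 < X\<close> \<open>X \<le> x\<close> by (intro Henstock_Kurzweil_Integration.integral_combine[symmetric] int) auto
    ultimately show ?thesis using tail' unfolding M by linarith
  qed
qed

text \<open>
  The defining inequality of the class moves the weight from \<open>t\<close> to the right endpoint \<open>x\<close> and replaces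
  it by \<open>t\<^sup>q e\<^bsup>-\<eta>t\<^esup>\<close>. What remains is the pure power case with damping \<open>\<gamma> + \<eta>\<close>, and the constant of the
  class is the one of that case.
\<close>

lemma weight_class_integral_bound:
  assumes \<mu>: "\<mu> > -1" and q: "q > -1" and \<gamma>: "0 < \<gamma>" and \<eta>: "0 \<le> \<eta>"
    and \<theta>: "\<gamma> + \<eta> < \<theta>" "\<theta> < 1" and w: "w \<in> weight_class q \<eta>"
  shows "bessel_integral_bound \<mu> \<gamma> w (M_eta_const \<eta> \<mu> q \<gamma> \<theta>)"
  unfolding bessel_integral_bound_def
proof (intro allI impI)
  fix x :: real assume x: "0 < x"
  define \<delta> where "\<delta> = \<gamma> + \<eta>"
  have \<delta>: "0 < \<delta>" "\<delta> < \<theta>" using \<gamma> \<eta> \<theta> by (auto simp: \<delta>_def)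
  have M: "M_eta_const \<eta> \<mu> q \<gamma> \<theta> = M_const \<mu> q \<delta> \<theta>"
    by (simp add: M_eta_const_def M_const_def \<delta>_def diff_diff_eq)
  have wpos: "0 < w t" if "0 < t" for t
    using w that by (auto simp: weight_class_def pos_measurable_def)
  define f where "f t = exp (- \<gamma> * t) * w t * t powr (- \<mu>) * bessel_I \<mu> t" for t
  define c where "c = 2 powr (- \<mu>) * exp (\<eta> * x) * (w x * x powr (- q))"
  have "0 < c" using wpos[OF x] x by (simp add: c_def)
  have f_eq: "f t = exp (- \<gamma> * t) * w t * (2 powr (- \<mu>) * bessel_clifford \<mu> (t\<^sup>2 / 4))" if "0 < t" for t
    using that by (simp add: f_def bessel_I_eq_clifford[OF \<mu> that] powr_divide powr_minus field_simps)
  have f_bound: "0 \<le> f t \<and> f t \<le> c * bessel_kernel \<mu> q \<delta> t" if t: "0 < t" "t < x" for t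
  proof
    have pos: "0 < bessel_clifford \<mu> (t\<^sup>2 / 4)" using \<mu> by (simp add: bessel_clifford_pos)
    then show "0 \<le> f t"
      using wpos[OF t(1)] by (simp add: f_eq[OF t(1)])
    have "w t * t powr (- q) \<le> exp (\<eta> * (x - t)) * (w x * x powr (- q))"
      using w t by (auto simp: weight_class_def)
    from mult_right_mono[OF this, of "t powr q"]
    have "w t \<le> exp (\<eta> * (x - t)) * (w x * x powr (- q)) * t powr q"
      using t by (simp add: mult.assoc powr_add[symmetric])
    then have "f t \<le> exp (- \<gamma> * t) * (exp (\<eta> * (x - t)) * (w x * x powr (- q)) * t powr q)
        * (2 powr (- \<mu>) * bessel_clifford \<mu> (t\<^sup>2 / 4))"
      unfolding f_eq[OF t(1)] using pos by (intro mult_right_mono mult_left_mono) auto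
    also have "\<dots> = c * bessel_kernel \<mu> q \<delta> t"
    proof -
      have "exp (- \<gamma> * t) * exp (\<eta> * (x - t)) = exp (\<eta> * x) * exp (- \<delta> * t)"
        by (simp add: exp_add[symmetric] \<delta>_def algebra_simps)
      then show ?thesis by (simp add: c_def bessel_kernel_def mult_ac)
    qed
    finally show "f t \<le> c * bessel_kernel \<mu> q \<delta> t" .
  qed
  have kint: "bessel_kernel \<mu> q \<delta> integrable_on {0<..<x}"
    using bessel_kernel_integral_undamped(1)[OF \<mu> q, of \<delta> x] \<delta> x by (simp add: integrable_on_Icc_iff_Ioo)
  from integrable_cmul[OF this, of c]
  have ckint: "(\<lambda>t. c * bessel_kernel \<mu> q \<delta> t) integrable_on {0<..<x}"
    by (simp only: real_scaleR_def)
  have fmeas: "f \<in> borel_measurable (lebesgue_on {0<..<x})"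
  proof -
    have "w \<in> borel_measurable (lebesgue_on {0<..})"
      using w by (simp add: weight_class_def pos_measurable_def)
    then have m1: "w \<in> borel_measurable (lebesgue_on {0<..<x})"
      by (rule measurable_restrict_mono) auto
    have m2: "(\<lambda>t. exp (- \<gamma> * t)) \<in> borel_measurable (lebesgue_on {0<..<x})"
      by (rule continuous_imp_measurable_on_sets_lebesgue) (intro continuous_intros, simp)
    have m3: "(\<lambda>t. 2 powr (- \<mu>) * bessel_clifford \<mu> (t\<^sup>2 / 4)) \<in> borel_measurable (lebesgue_on {0<..<x})"
      by (rule continuous_imp_measurable_on_sets_lebesgue) (intro continuous_intros \<mu>, simp_all)
    have meas: "(\<lambda>t. exp (- \<gamma> * t) * w t * (2 powr (- \<mu>) * bessel_clifford \<mu> (t\<^sup>2 / 4)))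
        \<in> borel_measurable (lebesgue_on {0<..<x})"
      by (rule borel_measurable_times[OF borel_measurable_times[OF m2 m1] m3])
    show ?thesis
      by (subst measurable_cong[OF f_eq]) (use meas in auto)
  qed
  have fint: "set_integrable lebesgue {0<..<x} f"
    by (rule measurable_bounded_by_integrable_imp_absolutely_integrable[OF fmeas _ ckint])
       (use f_bound in auto)
  have "(LINT t:{0<..<x}|lebesgue. f t) = integral {0<..<x} f"
    by (rule set_lebesgue_integral_eq_integral(2)[OF fint])
  also have "\<dots> \<le> integral {0<..<x} (\<lambda>t. c * bessel_kernel \<mu> q \<delta> t)"
    using f_bound by (intro integral_le set_lebesgue_integral_eq_integral(1)[OF fint] ckint) auto
  also have "\<dots> = c * integral {0..x} (bessel_kernel \<mu> q \<delta>)"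
    by (simp add: integral_open_interval_real)
  also have "\<dots> \<le> c * (M_const \<mu> q \<delta> \<theta> * majorant \<mu> q \<delta> x)"
    using \<open>0 < c\<close> bessel_kernel_integral_bound[OF \<mu> q \<delta> \<theta>(2) x] by (intro mult_left_mono) auto
  also have "\<dots> = M_const \<mu> q \<delta> \<theta> * (exp (- \<gamma> * x) * w x * x powr (- \<mu>) * bessel_I (\<mu> + 1) x)"
  proof -
    have "c * majorant \<mu> q \<delta> x = exp (\<eta> * x) * exp (- \<delta> * x) * w x * (x powr (- q) * x powr (q + 1))
        * (2 powr (- \<mu>) * bessel_clifford (\<mu> + 1) (x\<^sup>2 / 4) / 2)"
      by (simp add: c_def majorant_def mult_ac)
    also have "exp (\<eta> * x) * exp (- \<delta> * x) = exp (- \<gamma> * x)"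
      by (simp add: exp_add[symmetric] \<delta>_def algebra_simps)
    also have "x powr (- q) * x powr (q + 1) = x"
      using x by (simp add: powr_add[symmetric])
    also have "exp (- \<gamma> * x) * w x * x * (2 powr (- \<mu>) * bessel_clifford (\<mu> + 1) (x\<^sup>2 / 4) / 2)
        = exp (- \<gamma> * x) * w x * x powr (- \<mu>) * bessel_I (\<mu> + 1) x"
      using x \<mu> by (simp add: bessel_I_eq_clifford powr_divide powr_minus powr_add field_simps)
    finally show ?thesis by (simp add: mult_ac)
  qed
  finally show "set_integrable lebesgue {0<..<x} (\<lambda>t. exp (- \<gamma> * t) * w t * t powr (- \<mu>) * bessel_I \<mu> t) \<and>
     (LINT t:{0<..<x}|lebesgue. exp (- \<gamma> * t) * w t * t powr (- \<mu>) * bessel_I \<mu> t)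
       \<le> M_eta_const \<eta> \<mu> q \<gamma> \<theta> * (exp (- \<gamma> * x) * w x * x powr (- \<mu>) * bessel_I (\<mu> + 1) x)"
    using fint unfolding f_def M by simp
qed

section \<open>Absolutely continuous functions with nonnegative derivative\<close>

lemma abs_continuous_imp_continuous_on:
  assumes f: "abs_continuous_on_interval a b f"
  shows "continuous_on {a..b} f"
  unfolding continuous_on_iff
proof (intro ballI allI impI)
  fix x \<epsilon> :: real assume x: "x \<in> {a..b}" and "0 < \<epsilon>"
  from f[unfolded abs_continuous_on_interval_def, THEN spec, THEN mp, OF \<open>0 < \<epsilon>\<close>]
  obtain \<delta> where "0 < \<delta>"
    and \<delta>: "\<forall>D. finite D \<and> (\<forall>(u, v)\<in>D. a \<le> u \<and> u \<le> v \<and> v \<le> b) \<and>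
           disjoint_family_on (\<lambda>(u, v). {u<..<v}) D \<and> (\<Sum>(u, v)\<in>D. v - u) < \<delta> \<longrightarrow>
           (\<Sum>(u, v)\<in>D. \<bar>f v - f u\<bar>) < \<epsilon>"
    by (elim exE conjE) (rule that)
  show "\<exists>d>0. \<forall>y\<in>{a..b}. dist y x < d \<longrightarrow> dist (f y) (f x) < \<epsilon>"
  proof (intro exI[of _ \<delta>] conjI ballI impI \<open>0 < \<delta>\<close>)
    fix y assume y: "y \<in> {a..b}" "dist y x < \<delta>"
    show "dist (f y) (f x) < \<epsilon>"
      using \<delta>[THEN spec, of "{(min x y, max x y)}"] x y
      by (auto simp: disjoint_family_on_def dist_real_def min_def max_def abs_if split: if_splits)
  qed
qed

lemma abs_continuous_exp_mult:
  assumes f: "abs_continuous_on_interval a b f" and \<eta>: "0 \<le> \<eta>"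
  shows "abs_continuous_on_interval a b (\<lambda>x. exp (\<eta> * x) * f x)"
  unfolding abs_continuous_on_interval_def
proof (intro allI impI)
  fix \<epsilon> :: real assume "0 < \<epsilon>"
  have "compact (f ` {a..b})"
    by (intro compact_continuous_image abs_continuous_imp_continuous_on[OF f]) auto
  then obtain B where "0 < B" and B: "\<And>x. x \<in> {a..b} \<Longrightarrow> \<bar>f x\<bar> \<le> B"
    using compact_imp_bounded bounded_pos by (metis image_eqI real_norm_def)
  define E where "E = exp (\<eta> * b)"
  have "0 < E" by (simp add: E_def)
  have exp_lip: "exp (\<eta> * v) - exp (\<eta> * u) \<le> E * \<eta> * (v - u)" if "u \<le> v" "v \<le> b" for u v
  proof -
    have "exp (\<eta> * v) - exp (\<eta> * u) = exp (\<eta> * v) * (1 - exp (\<eta> * u - \<eta> * v))"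
      by (simp add: right_diff_distrib exp_diff)
    also have "\<dots> \<le> exp (\<eta> * v) * (\<eta> * (v - u))"
      using exp_ge_add_one_self[of "\<eta> * u - \<eta> * v"] by (intro mult_left_mono) (auto simp: algebra_simps)
    also have "\<dots> \<le> E * (\<eta> * (v - u))"
      unfolding E_def using that \<eta> by (intro mult_right_mono) (auto intro: mult_left_mono)
    finally show ?thesis by (simp add: mult.assoc)
  qed
  \<comment> \<open>The increment of a product: the factor \<open>E\<close> bounds the exponential, \<open>B\<close> bounds \<open>f\<close>, and \<open>E \<eta>\<close> is a Lipschitz constant of the exponential.\<close>
  have incr: "\<bar>exp (\<eta> * v) * f v - exp (\<eta> * u) * f u\<bar> \<le> E * \<bar>f v - f u\<bar> + B * E * \<eta> * (v - u)"
    if uv: "a \<le> u" "u \<le> v" "v \<le> b" for u v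
  proof -
    have "exp (\<eta> * v) * f v - exp (\<eta> * u) * f u
        = exp (\<eta> * v) * (f v - f u) + f u * (exp (\<eta> * v) - exp (\<eta> * u))"
      by (simp add: algebra_simps)
    then have "\<bar>exp (\<eta> * v) * f v - exp (\<eta> * u) * f u\<bar>
        \<le> exp (\<eta> * v) * \<bar>f v - f u\<bar> + \<bar>f u\<bar> * \<bar>exp (\<eta> * v) - exp (\<eta> * u)\<bar>"
      by (metis abs_triangle_ineq abs_mult abs_exp_cancel)
    also have "\<dots> \<le> E * \<bar>f v - f u\<bar> + B * (E * \<eta> * (v - u))"
    proof (intro add_mono mult_mono)
      show "\<bar>exp (\<eta> * v) - exp (\<eta> * u)\<bar> \<le> E * \<eta> * (v - u)"
        using exp_lip[OF uv(2,3)] uv \<eta> by (simp add: mult_left_mono)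
      show "exp (\<eta> * v) \<le> E" using uv \<eta> by (simp add: E_def mult_left_mono)
    qed (use B uv \<open>0 < B\<close> \<open>0 < E\<close> in auto)
    finally show ?thesis by (simp add: mult.assoc)
  qed
  define \<epsilon>1 where "\<epsilon>1 = \<epsilon> / (2 * E)"
  have "0 < \<epsilon>1" using \<open>0 < \<epsilon>\<close> \<open>0 < E\<close> by (simp add: \<epsilon>1_def)
  from f[unfolded abs_continuous_on_interval_def, THEN spec, THEN mp, OF \<open>0 < \<epsilon>1\<close>]
  obtain \<delta> where "0 < \<delta>"
    and \<delta>: "\<forall>D. finite D \<and> (\<forall>(u, v)\<in>D. a \<le> u \<and> u \<le> v \<and> v \<le> b) \<and>
           disjoint_family_on (\<lambda>(u, v). {u<..<v}) D \<and> (\<Sum>(u, v)\<in>D. v - u) < \<delta> \<longrightarrow>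
           (\<Sum>(u, v)\<in>D. \<bar>f v - f u\<bar>) < \<epsilon>1"
    by (elim exE conjE) (rule that)
  define C where "C = 1 + B * E * \<eta>"
  have "0 < C" using \<open>0 < B\<close> \<open>0 < E\<close> \<eta> by (simp add: C_def add_pos_nonneg)
  define \<delta>' where "\<delta>' = min \<delta> (\<epsilon> / (2 * C))"
  show "\<exists>\<delta>>0. \<forall>D. finite D \<and> (\<forall>(u, v)\<in>D. a \<le> u \<and> u \<le> v \<and> v \<le> b) \<and>
        disjoint_family_on (\<lambda>(u, v). {u<..<v}) D \<and> (\<Sum>(u, v)\<in>D. v - u) < \<delta>
        \<longrightarrow> (\<Sum>(u, v)\<in>D. \<bar>exp (\<eta> * v) * f v - exp (\<eta> * u) * f u\<bar>) < \<epsilon>"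
  proof (intro exI[of _ \<delta>'] conjI allI impI)
    show "0 < \<delta>'" using \<open>0 < \<delta>\<close> \<open>0 < C\<close> \<open>0 < \<epsilon>\<close> by (simp add: \<delta>'_def)
    fix D :: "(real \<times> real) set"
    assume D: "finite D \<and> (\<forall>(u, v)\<in>D. a \<le> u \<and> u \<le> v \<and> v \<le> b) \<and>
        disjoint_family_on (\<lambda>(u, v). {u<..<v}) D \<and> (\<Sum>(u, v)\<in>D. v - u) < \<delta>'"
    have small: "(\<Sum>(u, v)\<in>D. \<bar>f v - f u\<bar>) < \<epsilon>1"
      by (rule \<delta>[THEN spec, THEN mp]) (use D in \<open>simp add: \<delta>'_def\<close>)
    have len: "0 \<le> (\<Sum>(u, v)\<in>D. v - u)"
      using D by (intro sum_nonneg) auto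
    have "(\<Sum>(u, v)\<in>D. \<bar>exp (\<eta> * v) * f v - exp (\<eta> * u) * f u\<bar>)
        \<le> (\<Sum>(u, v)\<in>D. E * \<bar>f v - f u\<bar> + B * E * \<eta> * (v - u))"
      using D incr by (intro sum_mono) auto
    also have "\<dots> = E * (\<Sum>(u, v)\<in>D. \<bar>f v - f u\<bar>) + B * E * \<eta> * (\<Sum>(u, v)\<in>D. v - u)"
      by (simp add: sum.distrib sum_distrib_left split_beta)
    also have "\<dots> \<le> E * (\<Sum>(u, v)\<in>D. \<bar>f v - f u\<bar>) + C * (\<Sum>(u, v)\<in>D. v - u)"
      using len by (simp add: C_def distrib_right)
    also have "\<dots> < E * \<epsilon>1 + C * (\<epsilon> / (2 * C))"
    proof (intro add_strict_mono mult_strict_left_mono)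
      show "(\<Sum>(u, v)\<in>D. v - u) < \<epsilon> / (2 * C)" using D by (simp add: \<delta>'_def)
    qed (use small \<open>0 < E\<close> \<open>0 < C\<close> in auto)
    also have "\<dots> = \<epsilon>"
      using \<open>0 < E\<close> \<open>0 < C\<close> by (simp add: \<epsilon>1_def)
    finally show "(\<Sum>(u, v)\<in>D. \<bar>exp (\<eta> * v) * f v - exp (\<eta> * u) * f u\<bar>) < \<epsilon>" .
  qed
qed

text \<open>
  By definition small total length forces small variation, and a null set has open neighbourhoods of
  arbitrarily small measure.
\<close>

lemma abs_continuous_variation_on_null_set:
  assumes f: "abs_continuous_on_interval a b f" and E: "E \<in> null_sets lebesgue" and "0 < \<epsilon>"
  shows "\<exists>U. open U \<and> E \<subseteq> U \<and>
    (\<forall>p. p tagged_partial_division_of {a..b} \<and> (\<forall>(x, K)\<in>p. K \<subseteq> U) \<longrightarrow>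
           (\<Sum>(x, K)\<in>p. \<bar>f (Sup K) - f (Inf K)\<bar>) < \<epsilon>)"
proof -
  from f[unfolded abs_continuous_on_interval_def, THEN spec, THEN mp, OF \<open>0 < \<epsilon>\<close>]
  obtain \<delta> where "0 < \<delta>"
    and \<delta>: "\<forall>D. finite D \<and> (\<forall>(u, v)\<in>D. a \<le> u \<and> u \<le> v \<and> v \<le> b) \<and>
           disjoint_family_on (\<lambda>(u, v). {u<..<v}) D \<and> (\<Sum>(u, v)\<in>D. v - u) < \<delta> \<longrightarrow>
           (\<Sum>(u, v)\<in>D. \<bar>f v - f u\<bar>) < \<epsilon>"
    by (elim exE conjE) (rule that)
  have Es: "E \<in> sets lebesgue" using E by auto
  obtain U where U: "open U" "E \<subseteq> U" "(U - E) \<in> lmeasurable" "emeasure lebesgue (U - E) < ennreal \<delta>"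
    using sets_lebesgue_outer_open[OF Es \<open>0 < \<delta>\<close>] by blast
  have Uem: "emeasure lebesgue U < ennreal \<delta>"
  proof -
    have "emeasure lebesgue (U - E) = emeasure lebesgue U"
      using E U(1) by (intro emeasure_Diff_null_set) auto
    then show ?thesis using U(4) by simp
  qed
  then have Ulm: "U \<in> lmeasurable"
    using U(1) by (intro fmeasurableI) (auto intro: less_trans)
  have Um: "measure lebesgue U < \<delta>"
    using Uem Ulm \<open>0 < \<delta>\<close> by (simp add: emeasure_eq_measure2 ennreal_less_iff)
  show ?thesis
  proof (intro exI[of _ U] conjI U(1,2) allI impI; elim conjE)
    fix p assume p: "p tagged_partial_division_of {a..b}" and pU: "\<forall>(x, K)\<in>p. K \<subseteq> U"
    note pD = tagged_partial_division_ofD[OF p]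
    have td: "p tagged_division_of (\<Union>(snd ` p))"
      by (rule tagged_partial_division_of_Union_self[OF p])
    have dv: "snd ` p division_of (\<Union>(snd ` p))"
      by (rule division_of_tagged_division[OF td])
    have K: "\<exists>u v. K = {u..v} \<and> u \<le> v \<and> a \<le> u \<and> v \<le> b" if Kp: "K \<in> snd ` p" for K
    proof -
      obtain x where x: "(x, K) \<in> p" using Kp by force
      then obtain u v where uv: "K = {u..v}" using pD(4) by (metis box_real(2))
      then have "u \<le> v" using pD(2)[OF x] by auto
      then show ?thesis using pD(3)[OF x] uv by auto
    qed
    \<comment> \<open>One interval can carry several tags only if it is degenerate, so the division is encoded by its set of intervals and degenerate ones contribute nothing.\<close>
    define D where "D = (\<lambda>K. (Inf K, Sup K)) ` snd ` p"
    have inj: "inj_on (\<lambda>K. (Inf K, Sup K)) (snd ` p)"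
    proof (rule inj_onI)
      fix K K' :: "real set" assume *: "K \<in> snd ` p" "K' \<in> snd ` p" "(Inf K, Sup K) = (Inf K', Sup K')"
      obtain u v where "K = {u..v}" "u \<le> v" using K[OF *(1)] by blast
      moreover obtain u' v' where "K' = {u'..v'}" "u' \<le> v'" using K[OF *(2)] by blast
      ultimately show "K = K'" using *(3) by simp
    qed
    have "(\<Sum>(u, v)\<in>D. \<bar>f v - f u\<bar>) < \<epsilon>"
    proof (rule \<delta>[THEN spec, THEN mp], intro conjI)
      show "finite D" using pD(1) by (simp add: D_def)
      show "\<forall>(u, v)\<in>D. a \<le> u \<and> u \<le> v \<and> v \<le> b"
        using K unfolding D_def by force
      show "disjoint_family_on (\<lambda>(u, v). {u<..<v}) D"
        unfolding disjoint_family_on_def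
      proof (intro ballI impI)
        fix P Q assume PQ: "P \<in> D" "Q \<in> D" "P \<noteq> Q"
        obtain K1 where K1: "K1 \<in> snd ` p" "P = (Inf K1, Sup K1)" using PQ(1) unfolding D_def by blast
        obtain K2 where K2: "K2 \<in> snd ` p" "Q = (Inf K2, Sup K2)" using PQ(2) unfolding D_def by blast
        have "interior K1 \<inter> interior K2 = {}"
          using division_ofD(5)[OF dv K1(1) K2(1)] PQ(3) K1(2) K2(2) by blast
        moreover obtain u v where "K1 = {u..v}" "u \<le> v" using K[OF K1(1)] by blast
        moreover obtain u' v' where "K2 = {u'..v'}" "u' \<le> v'" using K[OF K2(1)] by blast
        ultimately show "(case P of (u, v) \<Rightarrow> {u<..<v}) \<inter> (case Q of (u, v) \<Rightarrow> {u<..<v}) = {}"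
          by (simp add: K1(2) K2(2))
      qed
      have "(\<Sum>(u, v)\<in>D. v - u) = (\<Sum>K\<in>snd ` p. Sup K - Inf K)"
        unfolding D_def by (simp add: sum.reindex[OF inj])
      also have "\<dots> = (\<Sum>K\<in>snd ` p. measure lebesgue K)"
      proof (rule sum.cong[OF refl])
        fix K assume "K \<in> snd ` p"
        then obtain u v where "K = {u..v}" "u \<le> v" using K by blast
        then show "Sup K - Inf K = measure lebesgue K" by simp
      qed
      also have "\<dots> = measure lebesgue (\<Union>(snd ` p))"
        by (rule content_division[OF dv])
      also have "\<dots> \<le> measure lebesgue U"
      proof (rule measure_mono_fmeasurable[OF _ _ Ulm])
        show "\<Union> (snd ` p) \<subseteq> U" using pU by fastforce
        show "\<Union> (snd ` p) \<in> sets lebesgue" using lmeasurable_division[OF dv] by auto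
      qed
      finally show "(\<Sum>(u, v)\<in>D. v - u) < \<delta>" using Um by simp
    qed
    also have "(\<Sum>(u, v)\<in>D. \<bar>f v - f u\<bar>) = (\<Sum>K\<in>snd ` p. \<bar>f (Sup K) - f (Inf K)\<bar>)"
      unfolding D_def by (simp add: sum.reindex[OF inj])
    \<comment> \<open>The empty set is singled out because \<^const>\<open>Sup\<close> and \<^const>\<open>Inf\<close> have unspecified values there.\<close>
    also have "\<dots> = (\<Sum>K\<in>snd ` p. if K = {} then 0 else \<bar>f (Sup K) - f (Inf K)\<bar>)"
    proof (rule sum.cong[OF refl])
      fix K assume "K \<in> snd ` p"
      then have "K \<noteq> {}" using K by force
      then show "\<bar>f (Sup K) - f (Inf K)\<bar> = (if K = {} then 0 else \<bar>f (Sup K) - f (Inf K)\<bar>)"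
        by simp
    qed
    also have "\<dots> = (\<Sum>(x, K)\<in>p. if K = {} then 0 else \<bar>f (Sup K) - f (Inf K)\<bar>)"
    proof (rule sum.over_tagged_division_lemma[OF td, symmetric])
      fix u v :: real assume "box u v = {}"
      then have "cbox u v = {} \<or> cbox u v = {u}" by auto
      then show "(if cbox u v = {} then 0 else \<bar>f (Sup (cbox u v)) - f (Inf (cbox u v))\<bar>) = 0"
        by auto
    qed
    also have "\<dots> = (\<Sum>(x, K)\<in>p. \<bar>f (Sup K) - f (Inf K)\<bar>)"
    proof (rule sum.cong[OF refl], clarify)
      fix x K assume "(x, K) \<in> p"
      then have "K \<noteq> {}" using pD(2) by blast
      then show "(if K = {} then 0 else \<bar>f (Sup K) - f (Inf K)\<bar>) = \<bar>f (Sup K) - f (Inf K)\<bar>"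
        by simp
    qed
    finally show "(\<Sum>(x, K)\<in>p. \<bar>f (Sup K) - f (Inf K)\<bar>) < \<epsilon>" .
  qed
qed

text \<open>
  A version of the straddle lemma: at a point with nonnegative derivative, the increment of \<open>f\<close> over a
  short interval around that point is almost nonnegative.
\<close>

lemma DERIV_nonneg_lower_straddle:
  fixes f :: "real \<Rightarrow> real"
  assumes "(f has_real_derivative D) (at x)" "0 \<le> D" "0 < \<epsilon>"
  shows "\<exists>r>0. \<forall>u v. u \<le> x \<longrightarrow> x \<le> v \<longrightarrow> {u..v} \<subseteq> ball x r \<longrightarrow> - \<epsilon> * (v - u) \<le> f v - f u"
proof -
  have "(f has_derivative (\<lambda>h. D * h)) (at x)"
    using assms(1) by (simp add: has_field_derivative_def)
  then obtain r where "0 < r"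
    and r: "\<And>y. norm (y - x) < r \<Longrightarrow> norm (f y - f x - D * (y - x)) \<le> \<epsilon> * norm (y - x)"
    using \<open>0 < \<epsilon>\<close> unfolding has_derivative_at_alt by blast
  show ?thesis
  proof (intro exI[of _ r] conjI \<open>0 < r\<close> allI impI)
    fix u v assume uv: "u \<le> x" "x \<le> v" "{u..v} \<subseteq> ball x r"
    then have "u \<in> {u..v}" "v \<in> {u..v}" by auto
    then have "u \<in> ball x r" "v \<in> ball x r" using uv(3) by blast+
    then have "\<bar>f u - f x - D * (u - x)\<bar> \<le> \<epsilon> * (x - u)" "\<bar>f v - f x - D * (v - x)\<bar> \<le> \<epsilon> * (v - x)"
      using r[of u] r[of v] uv by (auto simp: dist_real_def)
    then have "f u - f x - D * (u - x) \<le> \<epsilon> * (x - u)" "- (\<epsilon> * (v - x)) \<le> f v - f x - D * (v - x)"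
      by linarith+
    moreover have "0 \<le> D * (v - x)" "D * (u - x) \<le> 0"
      using uv \<open>0 \<le> D\<close> by (auto simp: mult_nonneg_nonpos)
    moreover have "\<epsilon> * (v - u) = \<epsilon> * (v - x) + \<epsilon> * (x - u)" by (simp add: algebra_simps)
    ultimately show "- \<epsilon> * (v - u) \<le> f v - f u" by simp
  qed
qed

text \<open>
  A monotonicity criterion, proved with a gauge. At points with nonnegative derivative the
  gauge is a ball from the straddle lemma; on the exceptional null set \<open>E\<close> it is an open set \<open>U\<close> on
  which \<open>f\<close> has variation below \<open>e/2\<close>. Cousin's lemma yields a fine tagged division. Summing the
  increments of \<open>f\<close> over it, the intervals tagged in \<open>E\<close> and the other intervals each lose at most
  \<open>e/2\<close>.
\<close>

lemma abs_continuous_deriv_nonneg_AE_imp_le: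
  assumes "a \<le> b" and f: "abs_continuous_on_interval a b f"
    and ae: "AE x in lebesgue. x \<in> {a..b} \<longrightarrow> (\<exists>D\<ge>0. (f has_real_derivative D) (at x))"
  shows "f a \<le> f b"
proof (rule field_le_epsilon)
  fix e :: real assume "0 < e"
  \<comment> \<open>The added \<open>1\<close> avoids a division by zero when \<open>a = b\<close>.\<close>
  define \<epsilon> where "\<epsilon> = e / (2 * (b - a + 1))"
  have "0 < \<epsilon>" using \<open>0 < e\<close> \<open>a \<le> b\<close> by (simp add: \<epsilon>_def)
  obtain E where E: "E \<in> null_sets lebesgue"
    and good: "\<And>x. x \<in> {a..b} - E \<Longrightarrow> \<exists>D\<ge>0. (f has_real_derivative D) (at x)"
  proof -
    obtain E where "E \<in> null_sets lebesgue"
      and "{x \<in> space lebesgue. \<not> (x \<in> {a..b} \<longrightarrow> (\<exists>D\<ge>0. (f has_real_derivative D) (at x)))} \<subseteq> E"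
      using ae unfolding eventually_ae_filter by blast
    then show thesis by (intro that[of E]) auto
  qed
  from abs_continuous_variation_on_null_set[OF f E half_gt_zero[OF \<open>0 < e\<close>]]
  obtain U where U: "open U" "E \<subseteq> U"
    and small: "\<forall>p. p tagged_partial_division_of {a..b} \<and> (\<forall>(x, K)\<in>p. K \<subseteq> U) \<longrightarrow>
           (\<Sum>(x, K)\<in>p. \<bar>f (Sup K) - f (Inf K)\<bar>) < e / 2"
    by (elim exE conjE) (rule that)
  have "\<exists>r>0. \<forall>u v. u \<le> x \<longrightarrow> x \<le> v \<longrightarrow> {u..v} \<subseteq> ball x r \<longrightarrow> - \<epsilon> * (v - u) \<le> f v - f u"
    if x: "x \<in> {a..b} - E" for x
    using good[OF x] DERIV_nonneg_lower_straddle[OF _ _ \<open>0 < \<epsilon>\<close>, of f _ x] by blast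
  then obtain r where r: "\<And>x. x \<in> {a..b} - E \<Longrightarrow> 0 < r x"
    and straddle: "\<And>x u v. x \<in> {a..b} - E \<Longrightarrow> u \<le> x \<Longrightarrow> x \<le> v \<Longrightarrow> {u..v} \<subseteq> ball x (r x) \<Longrightarrow>
                     - \<epsilon> * (v - u) \<le> f v - f u"
    by metis
  define g where "g x = (if x \<in> E then U else if x \<in> {a..b} then ball x (r x) else UNIV)" for x
  have "gauge g"
    using U r by (auto simp: g_def intro!: gaugeI)
  then obtain p where p: "p tagged_division_of {a..b}" and fine: "g fine p"
    by (rule fine_division_exists_real)
  note pD = tagged_division_ofD[OF p]
  let ?d = "\<lambda>(x, K). f (Sup K) - f (Inf K)"
  define P where "P = {(x, K) \<in> p. x \<in> E}"
  have "P \<subseteq> p" "finite p" using pD(1) by (auto simp: P_def)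
  have int: "\<exists>u v. K = {u..v} \<and> u \<le> x \<and> x \<le> v \<and> x \<in> {a..b}" if "(x, K) \<in> p" for x K
    using pD(2,3,4)[OF that] by (auto simp: subset_iff)
  have "(\<Sum>(x, K)\<in>P. \<bar>f (Sup K) - f (Inf K)\<bar>) < e / 2"
  proof (rule small[THEN spec, THEN mp], intro conjI)
    show "P tagged_partial_division_of {a..b}"
      using p \<open>P \<subseteq> p\<close> tagged_partial_division_subset unfolding tagged_division_of_def by blast
    show "\<forall>(x, K)\<in>P. K \<subseteq> U"
      using fine unfolding fine_def g_def P_def by force
  qed
  moreover have "(\<Sum>(x, K)\<in>P. - \<bar>f (Sup K) - f (Inf K)\<bar>) \<le> sum ?d P"
    by (rule sum_mono) auto
  ultimately have bad: "- (e / 2) \<le> sum ?d P"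
    by (simp add: sum_negf split_beta)
  have "(\<Sum>(x, K)\<in>p - P. - \<epsilon> * measure lborel K) \<le> sum ?d (p - P)"
  proof (rule sum_mono, clarify)
    fix x K assume xK: "(x, K) \<in> p" "(x, K) \<notin> P"
    obtain u v where uv: "K = {u..v}" "u \<le> x" "x \<le> v" "x \<in> {a..b}" using int[OF xK(1)] by blast
    have "x \<notin> E" using xK by (simp add: P_def)
    moreover have "K \<subseteq> g x" using fine xK(1) unfolding fine_def by blast
    ultimately have "{u..v} \<subseteq> ball x (r x)" using uv by (simp add: g_def)
    then show "- \<epsilon> * measure lborel K \<le> f (Sup K) - f (Inf K)"
      using straddle[of x u v] uv \<open>x \<notin> E\<close> by simp
  qed
  moreover have "(\<Sum>(x, K)\<in>p. - \<epsilon> * measure lborel K) \<le> (\<Sum>(x, K)\<in>p - P. - \<epsilon> * measure lborel K)"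
    using \<open>0 < \<epsilon>\<close> \<open>finite p\<close> \<open>P \<subseteq> p\<close>
    by (subst sum.subset_diff[OF \<open>P \<subseteq> p\<close> \<open>finite p\<close>]) (auto intro!: sum_nonpos)
  moreover have "(\<Sum>(x, K)\<in>p. - \<epsilon> * measure lborel K) = - \<epsilon> * (b - a)"
    using additive_content_tagged_division[of p a b] p \<open>a \<le> b\<close>
    by (simp add: sum_distrib_left[symmetric] split_beta sum_negf)
  moreover have "\<epsilon> * (b - a) \<le> e / 2"
  proof -
    have "\<epsilon> * (b - a) \<le> \<epsilon> * (b - a + 1)" using \<open>0 < \<epsilon>\<close> by simp
    also have "\<dots> = e / 2"
    proof -
      have "b - a + 1 \<noteq> 0" using \<open>a \<le> b\<close> by simp
      then show ?thesis
        unfolding \<epsilon>_def times_divide_eq_left by (rule nonzero_mult_divide_mult_cancel_right)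
    qed
    finally show ?thesis .
  qed
  ultimately have "- (e / 2) \<le> sum ?d (p - P)" by simp
  moreover have "sum ?d p = sum ?d (p - P) + sum ?d P"
    using sum.subset_diff[OF \<open>P \<subseteq> p\<close> \<open>finite p\<close>] .
  moreover have "sum ?d p = f b - f a"
    by (rule additive_tagged_division_1[OF \<open>a \<le> b\<close> p])
  ultimately show "f a \<le> f b + e" using bad by linarith
qed

text \<open>
  The lower bound on \<open>L'/L\<close> says that \<open>e\<^bsup>\<eta>x\<^esup> L(x)\<close> has a nonnegative derivative almost everywhere, and this
  product is again absolutely continuous; so it is nondecreasing.
\<close>

lemma log_deriv_ge_ae_imp_exp_growth:
  assumes L: "\<And>x. 0 < x \<Longrightarrow> 0 < L x" "abs_continuous_on_pos L" "log_deriv_ge_ae L (- \<eta>)"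
    and "0 \<le> \<eta>" "0 < t" "t \<le> x"
  shows "L t \<le> exp (\<eta> * (x - t)) * L x"
proof -
  have "exp (\<eta> * t) * L t \<le> exp (\<eta> * x) * L x"
  proof (rule abs_continuous_deriv_nonneg_AE_imp_le[OF \<open>t \<le> x\<close>])
    show "abs_continuous_on_interval t x (\<lambda>s. exp (\<eta> * s) * L s)"
      using assms by (intro abs_continuous_exp_mult) (auto simp: abs_continuous_on_pos_def)
    show "AE s in lebesgue. s \<in> {t..x} \<longrightarrow>
        (\<exists>D\<ge>0. ((\<lambda>s. exp (\<eta> * s) * L s) has_real_derivative D) (at s))"
      using L(3) unfolding log_deriv_ge_ae_def
    proof eventually_elim
      fix s assume *: "0 < s \<longrightarrow> L differentiable at s \<and> - \<eta> \<le> deriv L s / L s"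
      show "s \<in> {t..x} \<longrightarrow> (\<exists>D\<ge>0. ((\<lambda>s. exp (\<eta> * s) * L s) has_real_derivative D) (at s))"
      proof
        assume "s \<in> {t..x}"
        then have "0 < s" using \<open>0 < t\<close> by auto
        then have der: "(L has_real_derivative deriv L s) (at s)" and ge: "- \<eta> \<le> deriv L s / L s"
          using * by (auto simp: DERIV_deriv_iff_real_differentiable)
        have "((\<lambda>s. exp (\<eta> * s) * L s) has_real_derivative exp (\<eta> * s) * (\<eta> * L s + deriv L s)) (at s)"
          by (rule derivative_eq_intros der refl)+ (simp add: algebra_simps)
        moreover have "0 \<le> exp (\<eta> * s) * (\<eta> * L s + deriv L s)"
          using ge L(1)[OF \<open>0 < s\<close>] by (intro mult_nonneg_nonneg) (simp_all add: field_simps)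
        ultimately show "\<exists>D\<ge>0. ((\<lambda>s. exp (\<eta> * s) * L s) has_real_derivative D) (at s)" by blast
      qed
    qed
  qed
  then have "exp (- (\<eta> * t)) * (exp (\<eta> * t) * L t) \<le> exp (- (\<eta> * t)) * (exp (\<eta> * x) * L x)"
    by (intro mult_left_mono) auto
  then show ?thesis
    by (simp add: mult.assoc[symmetric] exp_add[symmetric] right_diff_distrib)
qed

section \<open>Power functions times a positive factor\<close>

lemma pos_measurable_powr_mult:
  assumes L: "pos_measurable L" and w: "\<And>x. 0 < x \<Longrightarrow> w x = x powr q * L x"
  shows "pos_measurable w"
  unfolding pos_measurable_def
proof (intro conjI allI impI)
  fix x :: real assume "0 < x"
  then show "0 < w x" using L by (simp add: w pos_measurable_def)
next
  have "(\<lambda>x. x powr q) \<in> borel_measurable (lebesgue_on {0<..})"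
    by (rule continuous_imp_measurable_on_sets_lebesgue) (intro continuous_intros, auto)
  then have meas: "(\<lambda>x. x powr q * L x) \<in> borel_measurable (lebesgue_on {0<..})"
    using L by (intro borel_measurable_times) (auto simp: pos_measurable_def)
  show "w \<in> borel_measurable (lebesgue_on {0<..})"
    by (subst measurable_cong[OF w]) (use meas in auto)
qed

lemma pos_measurable_if_abs_continuous:
  assumes "\<And>x. 0 < x \<Longrightarrow> 0 < L x" "abs_continuous_on_pos L"
  shows "pos_measurable L"
proof -
  have "continuous (at x) L" if "0 < x" for x
  proof -
    have "continuous_on {x/2..x + 1} L"
      using assms(2) that by (intro abs_continuous_imp_continuous_on) (auto simp: abs_continuous_on_pos_def)
    then show ?thesis
      by (rule continuous_on_interior) (use that in auto)
  qed
  then have "continuous_on {0<..} L"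
    by (intro continuous_at_imp_continuous_on) auto
  then show ?thesis
    using assms(1) by (simp add: pos_measurable_def continuous_imp_measurable_on_sets_lebesgue)
qed

lemma pos_measurable_if_mono:
  assumes "\<And>x. 0 < x \<Longrightarrow> 0 < L x" "mono_on {0<..} L"
  shows "pos_measurable L"
proof -
  have "L \<in> borel_measurable (restrict_space borel {0<..})"
    by (rule borel_measurable_mono_on_fnc[OF assms(2)])
  then have "L \<in> borel_measurable (lebesgue_on {0<..})"
    by (metis borel_measurable_subalgebra lebesgue_on_UNIV_eq mono_restrict_space
        sets_completionI_sets sets_lborel space_borel space_lebesgue_on space_restrict_space subsetI)
  then show ?thesis using assms(1) by (simp add: pos_measurable_def)
qed

lemma upper_power_weight_imp_weight_class:
  assumes "upper_power_weight q w"
  shows "w \<in> weight_class q 0"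
  using assms by (auto simp: upper_power_weight_def weight_class_def mono_on_def)

lemma M_eta_const_0: "M_eta_const 0 \<mu> q \<gamma> \<theta> = M_const \<mu> q \<gamma> \<theta>"
  by (simp add: M_eta_const_def M_const_def)

lemma powr_mult_cancel:
  assumes "\<And>x. 0 < x \<Longrightarrow> w x = x powr q * L x" "0 < (x::real)"
  shows "w x * x powr (- q) = L x"
  using assms(2) by (simp add: assms(1) powr_minus)

lemma upper_power_weight_powr_mult_mono:
  assumes "\<And>x. 0 < x \<Longrightarrow> 0 < L x" "mono_on {0<..} L" and w: "\<And>x. 0 < x \<Longrightarrow> w x = x powr q * L x"
  shows "upper_power_weight q w"
  unfolding upper_power_weight_def
proof
  show "pos_measurable w"
    using pos_measurable_powr_mult[OF pos_measurable_if_mono[OF assms(1,2)] w] .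
  show "mono_on {0<..} (\<lambda>x. w x * x powr (- q))"
    using assms(2) by (auto simp: mono_on_def powr_mult_cancel[of w q L, OF w])
qed

lemma upper_power_weight_integral_bound:
  assumes "\<mu> > -1" "q > -1" "0 < \<gamma>" "\<gamma> < \<theta>" "\<theta> < 1" "upper_power_weight q w"
  shows "bessel_integral_bound \<mu> \<gamma> w (M_const \<mu> q \<gamma> \<theta>)"
  using weight_class_integral_bound[OF assms(1-3) order_refl _ assms(5)
      upper_power_weight_imp_weight_class[OF assms(6)]] assms(4)
  by (simp add: M_eta_const_0)

lemma regularly_varying_powr_mult:
  assumes L: "slowly_varying L" and w: "\<And>x. 0 < x \<Longrightarrow> w x = x powr q * L x"
  shows "regularly_varying q w"
  unfolding regularly_varying_def
proof (intro conjI allI impI)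
  show "pos_measurable w"
    using L by (intro pos_measurable_powr_mult[OF _ w]) (simp add: slowly_varying_def)
  fix c :: real assume c: "0 < c"
  have "((\<lambda>x. c powr q * (L (c * x) / L x)) \<longlongrightarrow> c powr q * 1) at_top"
    using L c by (intro tendsto_intros) (simp add: slowly_varying_def)
  moreover have "\<forall>\<^sub>F x in at_top. c powr q * (L (c * x) / L x) = w (c * x) / w x"
    using eventually_gt_at_top[of 0]
    by eventually_elim (use c in \<open>simp add: w powr_mult\<close>)
  ultimately show "((\<lambda>x. w (c * x) / w x) \<longlongrightarrow> c powr q) at_top"
    by (simp add: tendsto_cong)
qed

theorem theorem8p3:
  fixes \<mu> q \<gamma> :: real
  assumes "\<mu> > -1" and "q > -1" and "0 < \<gamma>" and "\<gamma> < 1"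
  shows
    "(\<forall>L w :: real \<Rightarrow> real.
        (\<forall>x>0. 0 < L x) \<and> abs_continuous_on_pos L \<and> mono_on {0<..} L \<and>
        (\<forall>x>0. w x = x powr q * L x) \<longrightarrow>
        upper_power_weight q w \<and>
        (\<forall>\<theta>. \<gamma> < \<theta> \<and> \<theta> < 1 \<longrightarrow> bessel_integral_bound \<mu> \<gamma> w (M_const \<mu> q \<gamma> \<theta>))) \<and>
     (\<forall>L w :: real \<Rightarrow> real.
        (\<forall>x>0. 0 < L x) \<and> mono_on {0<..} L \<and> slowly_varying L \<and>
        (\<forall>x>0. w x = x powr q * L x) \<longrightarrow>
        regularly_varying q w \<and>
        (\<forall>\<theta>. \<gamma> < \<theta> \<and> \<theta> < 1 \<longrightarrow> bessel_integral_bound \<mu> \<gamma> w (M_const \<mu> q \<gamma> \<theta>))) \<and>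
     (\<forall>(L :: real \<Rightarrow> real) (w :: real \<Rightarrow> real) \<eta>.
        (\<forall>x>0. 0 < L x) \<and> abs_continuous_on_pos L \<and>
        0 \<le> \<eta> \<and> \<eta> < 1 - \<gamma> \<and> log_deriv_ge_ae L (- \<eta>) \<and>
        (\<forall>x>0. w x = x powr q * L x) \<longrightarrow>
        w \<in> weight_class q \<eta> \<and>
        (\<forall>\<theta>. \<gamma> + \<eta> < \<theta> \<and> \<theta> < 1 \<longrightarrow> bessel_integral_bound \<mu> \<gamma> w (M_eta_const \<eta> \<mu> q \<gamma> \<theta>)))"
proof (intro conjI allI impI; elim conjE)
  fix L w :: "real \<Rightarrow> real"
  assume "\<forall>x>0. 0 < L x" "mono_on {0<..} L" "\<forall>x>0. w x = x powr q * L x"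
  then show "upper_power_weight q w"
    by (intro upper_power_weight_powr_mult_mono) auto
  then show "bessel_integral_bound \<mu> \<gamma> w (M_const \<mu> q \<gamma> \<theta>)" if "\<gamma> < \<theta>" "\<theta> < 1" for \<theta>
    using that assms by (intro upper_power_weight_integral_bound) auto
next
  fix L w :: "real \<Rightarrow> real"
  assume L: "\<forall>x>0. 0 < L x" "mono_on {0<..} L" "\<forall>x>0. w x = x powr q * L x"
  show "regularly_varying q w" if "slowly_varying L"
    using that L(3) by (intro regularly_varying_powr_mult[of L]) auto
  show "bessel_integral_bound \<mu> \<gamma> w (M_const \<mu> q \<gamma> \<theta>)" if "\<gamma> < \<theta>" "\<theta> < 1" for \<theta>
    using that assms L
    by (intro upper_power_weight_integral_bound upper_power_weight_powr_mult_mono[of L]) auto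
next
  fix L w :: "real \<Rightarrow> real" and \<eta> :: real
  assume pos: "\<forall>x>0. 0 < L x" and ac: "abs_continuous_on_pos L" and \<eta>: "0 \<le> \<eta>"
    and der: "log_deriv_ge_ae L (- \<eta>)" and w: "\<forall>x>0. w x = x powr q * L x"
  show "w \<in> weight_class q \<eta>"
    unfolding weight_class_def
  proof (intro CollectI conjI allI impI; (elim conjE)?)
    show "pos_measurable w"
      by (rule pos_measurable_powr_mult[of L]) (use pos ac w in \<open>auto intro: pos_measurable_if_abs_continuous\<close>)
    fix t x :: real assume tx: "0 < t" "t \<le> x"
    have "w t * t powr (- q) = L t" "w x * x powr (- q) = L x"
      using powr_mult_cancel[of w q L] w tx by auto
    then show "w t * t powr (- q) \<le> exp (\<eta> * (x - t)) * (w x * x powr (- q))"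
      using log_deriv_ge_ae_imp_exp_growth[of L \<eta> t x] pos ac der \<eta> tx by simp
  qed
  then show "bessel_integral_bound \<mu> \<gamma> w (M_eta_const \<eta> \<mu> q \<gamma> \<theta>)" if "\<gamma> + \<eta> < \<theta>" "\<theta> < 1" for \<theta>
    using that assms \<eta> by (intro weight_class_integral_bound) auto
qed

end
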